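(* There exists a finite alphabet $\mathcal{A}$ such that, for the full shift $X=\mathcal{A}^{\mathbb{Z}^2}$, the map $C(\mathcal{A}^{\mathbb{Z}^2}) \to \mathbb{R}$ that sends $\phi$ to the ground state entropy of $\phi$ is not computable.
   Context: $\mathcal{A}^{\mathbb{Z}^2}$ has the product topology and $(\sigma_g x)(h) = x(h+g)$. $M_\sigma(X)$ is the set of shift-invariant Borel probability measures on $X$; $h(\mu)$ is the measure-theoretic (Kolmogorov–Sinai) entropy of $\mu$. $C(\mathcal{A}^{\mathbb{Z}^2})$ is the space of continuous real-valued functions with the uniform norm. For $\phi$ in it, $P_X(\phi) = \sup_{\mu \in M_\sigma(X)}\left(h(\mu)+\int\phi\,d\mu\right)$ is the topological pressure; $\mu$ is an equilibrium state for $\phi$ if it attains the supremum (equilibrium states exist). A ground state for $\phi$ is any weak-* limit point, as $\beta\to\infty$, of equilibrium states for $\beta\phi$. All ground states for $\phi$ maximize $\int\phi\,d\nu$ over $\nu \in M_\sigma(X)$ and have the maximal entropy among such maximizing measures; the ground state entropy of $\phi$ is the common value of $h(\mu)$ over ground states $\mu$ for $\phi$. Computability. A function on $\mathcal{A}^{\mathbb{Z}^2}$ is locally constant if for some finite $E \subset \mathbb{Z}^2$ its value at $x$ depends only on $x|_E$. Fix a computable enumeration $(s_n)$ of all rational-valued locally constant functions, each given by a finite set $E$ and a finite table $\mathcal{A}^E \to \mathbb{Q}$. An oracle for $\phi$ is a function $\gamma : \mathbb{N} \to \mathbb{N}$ with $\|s_{\gamma(n)} - \phi\|_\infty < 2^{-n}$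 for all $n$. A function $f : C(\mathcal{A}^{\mathbb{Z}^2}) \to \mathbb{R}$ is computable if there is a Turing machine $T$ such that for every $\phi$, every oracle $\gamma$ for $\phi$ and every $n \in \mathbb{N}$, $|T(\gamma,n) - f(\phi)| < 2^{-n}$. *)

theory Defs
  imports "HOL-Probability.Probability" "HOL-Library.Nat_Bijection" "HOL-Library.Countable"
begin

section \<open>The full shift\<close>

text \<open>
  Finite alphabets are finite sets of natural numbers. The topology of \<^typ>\<open>nat\<close> is discrete, so
  the library topology on \<open>int \<times> int \<Rightarrow> nat\<close> is the product topology, and the full shift over \<open>A\<close>
  is a subspace of it carrying the product topology of \<open>A\<close>-valued configurations.
\<close>

type_synonym config = "int \<times> int \<Rightarrow> nat"

definition full_shift :: "nat set \<Rightarrow> config set" where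
  "full_shift A = {x. \<forall>g. x g \<in> A}"

definition shift :: "int \<times> int \<Rightarrow> config \<Rightarrow> config" where
  "shift g x = (\<lambda>h. x (h + g))"

definition cont_funs :: "nat set \<Rightarrow> (config \<Rightarrow> real) set" where
  "cont_funs A = {\<phi>. continuous_on (full_shift A) \<phi>}"

definition sup_norm :: "nat set \<Rightarrow> (config \<Rightarrow> real) \<Rightarrow> real" where
  "sup_norm A \<phi> = (SUP x\<in>full_shift A. \<bar>\<phi> x\<bar>)"

definition inv_measures :: "nat set \<Rightarrow> config measure set" where
  "inv_measures A = {\<mu>. prob_space \<mu> \<and> space \<mu> = full_shift A
     \<and> sets \<mu> = sets (restrict_space borel (full_shift A))
     \<and> (\<forall>g. distr \<mu> \<mu> (shift g) = \<mu>)}"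

section \<open>Kolmogorov--Sinai entropy\<close>

definition finite_partition :: "config measure \<Rightarrow> config set set \<Rightarrow> bool" where
  "finite_partition \<mu> P \<longleftrightarrow> finite P \<and> P \<subseteq> sets \<mu> \<and> partition_on (space \<mu>) P"

definition partition_entropy :: "config measure \<Rightarrow> config set set \<Rightarrow> real" where
  "partition_entropy \<mu> P = - (\<Sum>p\<in>P. measure \<mu> p * ln (measure \<mu> p))"

text \<open>The common refinement of the partitions \<open>(shift g)\<^sup>-\<^sup>1 P\<close> for \<open>g \<in> F\<close>.\<close>

definition refine :: "config measure \<Rightarrow> (int \<times> int) set \<Rightarrow> config set set \<Rightarrow> config set set" where
  "refine \<mu> F P = (\<lambda>c. {x \<in> space \<mu>. \<forall>g\<in>F. shift g x \<in> c g}) ` (F \<rightarrow>\<^sub>E P) - {{}}"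

definition box :: "nat \<Rightarrow> (int \<times> int) set" where
  "box n = {0..<int n} \<times> {0..<int n}"

definition entropy_rate :: "config measure \<Rightarrow> config set set \<Rightarrow> real" where
  "entropy_rate \<mu> P = lim (\<lambda>n. partition_entropy \<mu> (refine \<mu> (box n) P) / real (n ^ 2))"

text \<open>
  On a full shift over a finite alphabet \<open>A\<close> the supremum is at most \<open>ln (card A)\<close>, so taking it in
  the reals is harmless here (and likewise in the pressure below).
\<close>

definition ks_entropy :: "config measure \<Rightarrow> real" where
  "ks_entropy \<mu> = (SUP P\<in>{P. finite_partition \<mu> P}. entropy_rate \<mu> P)"

section \<open>Pressure, equilibrium states and ground states\<close>

definition pressure :: "nat set \<Rightarrow> (config \<Rightarrow> real) \<Rightarrow> real" where
  "pressure A \<phi> = (SUP \<mu>\<in>inv_measures A. ks_entropy \<mu> + (\<integral>x. \<phi> x \<partial>\<mu>))"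

definition equilibrium_state :: "nat set \<Rightarrow> (config \<Rightarrow> real) \<Rightarrow> config measure \<Rightarrow> bool" where
  "equilibrium_state A \<phi> \<mu> \<longleftrightarrow>
     \<mu> \<in> inv_measures A \<and> ks_entropy \<mu> + (\<integral>x. \<phi> x \<partial>\<mu>) = pressure A \<phi>"

definition weak_star_limit ::
    "nat set \<Rightarrow> (nat \<Rightarrow> config measure) \<Rightarrow> config measure \<Rightarrow> bool" where
  "weak_star_limit A \<mu>s \<mu> \<longleftrightarrow>
     (\<forall>f\<in>cont_funs A. (\<lambda>k. \<integral>x. f x \<partial>(\<mu>s k)) \<longlonglongrightarrow> (\<integral>x. f x \<partial>\<mu>))"

text \<open>
  The weak-* topology on \<^const>\<open>inv_measures\<close> is metrizable, so limit points as \<open>\<beta> \<rightarrow> \<infinity>\<close> are limits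
  along sequences of inverse temperatures tending to infinity.
\<close>

definition ground_state :: "nat set \<Rightarrow> (config \<Rightarrow> real) \<Rightarrow> config measure \<Rightarrow> bool" where
  "ground_state A \<phi> \<mu> \<longleftrightarrow> \<mu> \<in> inv_measures A \<and>
     (\<exists>\<beta> \<mu>s. filterlim \<beta> at_top sequentially
        \<and> (\<forall>k. equilibrium_state A (\<lambda>x. \<beta> k * \<phi> x) (\<mu>s k))
        \<and> weak_star_limit A \<mu>s \<mu>)"

definition ground_state_entropy :: "nat set \<Rightarrow> (config \<Rightarrow> real) \<Rightarrow> real" where
  "ground_state_entropy A \<phi> = (THE c. ks_entropy ` {\<mu>. ground_state A \<phi> \<mu>} = {c})"

section \<open>Rational-valued locally constant functions and oracles\<close>

text \<open>
  A code \<open>n\<close> is a pair of a list \<open>E\<close> of sites and a list of entries (pattern on \<open>E\<close>, rational value);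
  patterns without an entry get the value \<open>0\<close>.
\<close>

definition site_of_code :: "nat \<Rightarrow> int \<times> int" where
  "site_of_code k = map_prod int_decode int_decode (prod_decode k)"

definition entry_of_code :: "nat \<Rightarrow> nat list \<times> rat" where
  "entry_of_code k = map_prod list_decode nat_to_rat_surj (prod_decode k)"

definition loc_const :: "nat \<Rightarrow> config \<Rightarrow> real" where
  "loc_const n x =
     (let (e, t) = prod_decode n;
          E = map site_of_code (list_decode e);
          tab = map entry_of_code (list_decode t)
      in case map_of tab (map x E) of None \<Rightarrow> 0 | Some r \<Rightarrow> of_rat r)"

definition rational_locally_constant :: "nat set \<Rightarrow> (config \<Rightarrow> real) \<Rightarrow> bool" where
  "rational_locally_constant A f \<longleftrightarrow> (\<forall>x\<in>full_shift A. f x \<in> \<rat>) \<and>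
     (\<exists>E. finite E \<and> (\<forall>x\<in>full_shift A. \<forall>y\<in>full_shift A. (\<forall>g\<in>E. x g = y g) \<longrightarrow> f x = f y))"

lemma surj_site_of_code: "surj site_of_code"
proof (rule surjI)
  fix p :: "int \<times> int"
  show "site_of_code (prod_encode (map_prod int_encode int_encode p)) = p"
    by (cases p) (simp add: site_of_code_def)
qed

lemma surj_entry_of_code: "surj entry_of_code"
proof -
  have "\<exists>k. (w, r) = entry_of_code k" for w r
  proof -
    obtain m where "r = nat_to_rat_surj m" using surj_nat_to_rat_surj by (metis surjD)
    then show ?thesis
      by (intro exI[of _ "prod_encode (list_encode w, m)"]) (simp add: entry_of_code_def)
  qed
  then show ?thesis by (auto simp: surj_def)
qed

lemma loc_const_code:
  "\<exists>n. \<forall>x. loc_const n x = (case map_of tab (map x E) of None \<Rightarrow> 0 | Some r \<Rightarrow> of_rat r)"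
proof -
  have "map site_of_code (map (inv site_of_code) E) = E"
    unfolding map_map by (rule map_idI) (simp add: surj_f_inv_f[OF surj_site_of_code])
  moreover have "map entry_of_code (map (inv entry_of_code) tab) = tab"
    unfolding map_map by (rule map_idI) (simp add: surj_f_inv_f[OF surj_entry_of_code])
  ultimately show ?thesis
    by (intro exI[of _ "prod_encode (list_encode (map (inv site_of_code) E),
            list_encode (map (inv entry_of_code) tab))"])
       (simp add: loc_const_def del: map_map)
qed

lemma rational_locally_constant_loc_const: "rational_locally_constant A (loc_const n)"
proof -
  obtain e t where et: "prod_decode n = (e, t)" by (cases "prod_decode n") auto
  define E where "E = map site_of_code (list_decode e)"
  have "loc_const n x = loc_const n y" if "\<forall>g\<in>set E. x g = y g" for x y
  proof -
    have "map x E = map y E" using that by simp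
    then show ?thesis by (simp only: loc_const_def et E_def Let_def prod.case)
  qed
  moreover have "loc_const n x \<in> \<rat>" for x
    by (simp add: loc_const_def et split: option.split)
  ultimately show ?thesis unfolding rational_locally_constant_def by blast
qed

lemma loc_const_exhaustive:
  assumes "finite A" and "rational_locally_constant A f"
  shows "\<exists>n. \<forall>x\<in>full_shift A. loc_const n x = f x"
proof -
  obtain F where F: "finite F"
    "\<And>x y. x \<in> full_shift A \<Longrightarrow> y \<in> full_shift A \<Longrightarrow> \<forall>g\<in>F. x g = y g \<Longrightarrow> f x = f y"
    using assms(2) unfolding rational_locally_constant_def by blast
  obtain E where E: "set E = F" using finite_list[OF F(1)] by blast
  define W where "W = (\<lambda>x. map x E) ` full_shift A"
  have "W \<subseteq> {w. set w \<subseteq> A \<and> length w = length E}"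
    by (auto simp: W_def full_shift_def)
  then have "finite W" using finite_lists_length_eq[OF assms(1)] finite_subset by blast
  then obtain ws where ws: "set ws = W" using finite_list by blast
  define v where "v w = (SOME r. \<exists>x\<in>full_shift A. map x E = w \<and> f x = of_rat r)" for w
  have v: "f x = of_rat (v (map x E))" if x: "x \<in> full_shift A" for x
  proof -
    have "f x \<in> \<rat>" using x assms(2) by (simp add: rational_locally_constant_def)
    then obtain r where "f x = of_rat r" by (auto elim: Rats_cases)
    then have "\<exists>r. \<exists>y\<in>full_shift A. map y E = map x E \<and> f y = of_rat r" using x by blast
    then have "\<exists>y\<in>full_shift A. map y E = map x E \<and> f y = of_rat (v (map x E))"
      unfolding v_def by (rule someI_ex)
    then obtain y where y: "y \<in> full_shift A" "map y E = map x E" "f y = of_rat (v (map x E))"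
      by blast
    have "f x = f y" using F(2)[OF x y(1)] y(2) E by (metis map_eq_conv)
    then show ?thesis using y by simp
  qed
  have tab: "map_of (map (\<lambda>w. (w, v w)) ws) (map x E) = Some (v (map x E))"
    if "x \<in> full_shift A" for x
  proof -
    have "map x E \<in> set ws" using that ws W_def by blast
    then show ?thesis by (simp add: map_of_map_restrict)
  qed
  obtain n where n: "\<And>x. loc_const n x =
      (case map_of (map (\<lambda>w. (w, v w)) ws) (map x E) of None \<Rightarrow> 0 | Some r \<Rightarrow> of_rat r)"
    using loc_const_code by blast
  have "loc_const n x = f x" if "x \<in> full_shift A" for x
    unfolding n tab[OF that] using v[OF that] by simp
  then show ?thesis by blast
qed

definition oracle_for :: "nat set \<Rightarrow> (config \<Rightarrow> real) \<Rightarrow> (nat \<Rightarrow> nat) \<Rightarrow> bool" where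
  "oracle_for A \<phi> \<gamma> \<longleftrightarrow> (\<forall>n. sup_norm A (\<lambda>x. loc_const (\<gamma> n) x - \<phi> x) < (1/2) ^ n)"

section \<open>Oracle Turing machines\<close>

text \<open>
  Machines have a two-sided infinite work tape and a two-sided infinite oracle tape. A tape is
  recorded relative to its head, which is always at cell \<open>0\<close>; the blank symbol is \<open>0\<close>. Numbers are
  written in unary starting at the head. In the query state the number \<open>m\<close> on the oracle tape is
  replaced by \<open>\<gamma> m\<close> in one step. A machine halts when no transition applies, and its output is the
  number on the work tape.
\<close>

type_synonym tape = "int \<Rightarrow> nat"

datatype head_move = Move_Left | Move_Right | No_Move

fun move_head :: "head_move \<Rightarrow> tape \<Rightarrow> tape" where
  "move_head Move_Left t = (\<lambda>i. t (i - 1))"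
| "move_head Move_Right t = (\<lambda>i. t (i + 1))"
| "move_head No_Move t = t"

definition tape_action :: "nat \<times> head_move \<Rightarrow> tape \<Rightarrow> tape" where
  "tape_action a t = move_head (snd a) (t(0 := fst a))"

definition unary :: "nat \<Rightarrow> tape" where
  "unary n = (\<lambda>i. if 0 \<le> i \<and> i < int n then 1 else 0)"

definition tape_value :: "tape \<Rightarrow> nat" where
  "tape_value t = (LEAST k. t (int k) \<noteq> 1)"

text \<open>The transition table maps (state, work symbol, oracle symbol) to (state, actions on both tapes).\<close>

record oracle_tm =
  init_state :: nat
  query_state :: nat
  answer_state :: nat
  transitions :: "nat \<times> nat \<times> nat \<rightharpoonup> nat \<times> (nat \<times> head_move) \<times> (nat \<times> head_move)"

definition wf_tm :: "oracle_tm \<Rightarrow> bool" where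
  "wf_tm M \<longleftrightarrow> finite (dom (transitions M))"

type_synonym tm_config = "nat \<times> tape \<times> tape"

fun tm_step :: "oracle_tm \<Rightarrow> (nat \<Rightarrow> nat) \<Rightarrow> tm_config \<Rightarrow> tm_config option" where
  "tm_step M \<gamma> (q, w, u) =
     (if q = query_state M then Some (answer_state M, w, unary (\<gamma> (tape_value u)))
      else map_option (\<lambda>(q', a, b). (q', tape_action a w, tape_action b u))
             (transitions M (q, w 0, u 0)))"

definition tm_outputs :: "oracle_tm \<Rightarrow> (nat \<Rightarrow> nat) \<Rightarrow> nat \<Rightarrow> nat \<Rightarrow> bool" where
  "tm_outputs M \<gamma> n v \<longleftrightarrow>
     (\<exists>q w u. (\<lambda>c d. tm_step M \<gamma> c = Some d)\<^sup>*\<^sup>* (init_state M, unary n, unary 0) (q, w, u)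
        \<and> tm_step M \<gamma> (q, w, u) = None \<and> v = tape_value w)"

text \<open>The output number is read as a code of a rational approximation of the value of \<open>f\<close>.\<close>

definition computable_functional :: "nat set \<Rightarrow> ((config \<Rightarrow> real) \<Rightarrow> real) \<Rightarrow> bool" where
  "computable_functional A f \<longleftrightarrow>
     (\<exists>M. wf_tm M \<and> (\<forall>\<phi>\<in>cont_funs A. \<forall>\<gamma>. oracle_for A \<phi> \<gamma> \<longrightarrow>
        (\<forall>n. \<exists>v. tm_outputs M \<gamma> n v \<and> \<bar>of_rat (nat_to_rat_surj v) - f \<phi>\<bar> < (1/2) ^ n)))"

end

theory Submission
  imports Defs "HOL-Real_Asymp.Real_Asymp"
begin

text \<open>
  A computable functional is continuous, and ground state entropy is not, already over the
  alphabet \<open>{0, 1}\<close>. For \<open>\<phi> = 0\<close> the energy term vanishes, every ground state has maximal entropy,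
  and the value is \<open>ln 2\<close>. For \<open>\<phi> = c * of_bool (x 0 = 0)\<close> with an arbitrarily small \<open>c > 0\<close>, cooling
  freezes the system into the constant configuration \<open>0\<close>, and the value is \<open>0\<close>. A halting run on an
  oracle for the zero function has asked finitely many questions, so some oracle for such a \<open>\<phi>\<close>
  gives the same answers and forces the same output (\<open>computable_functional_near_zero\<close>).

  Both values rest on computing entropy from the letters alone. The letter partition generates:
  any measurable set is approximated by sets that depend on finitely many letters, so a partition
  is a function of a slightly larger block of letters together with rare errors, which carry little
  entropy (\<open>obs_rate_cell_le_letter\<close>). Since block entropies of squares are subadditive, the entropy
  of an invariant measure is the infimum of its normalized block entropies
  (\<open>ks_entropy_tendsto\<close>, \<open>ks_entropy_le_block\<close>). This has two consequences. First, blocks of size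
  one and the Gibbs inequality bound the pressure of a potential that depends on a single letter,
  and a Bernoulli measure attains the bound (\<open>gibbs_equilibrium_state\<close>). Second, each block entropy
  is weak-* continuous, so their infimum is upper semicontinuous
  (\<open>ks_entropy_upper_semicontinuous\<close>).

  At \<open>\<phi> = 0\<close> the uniform Bernoulli measure is an equilibrium state at every temperature, hence a
  ground state, and semicontinuity carries the maximal entropy to every other ground state. For the
  indicator potential the Bernoulli equilibrium states converge to the point mass at the constant
  configuration; any ground state gives probability one to the letter \<open>0\<close>, because entropy can
  compensate an energy loss of at most \<open>ln (card A)\<close>, so its letter entropy and its entropy vanish.
\<close>

(* Simplification would turn each quantifier over sites into two quantifiers over coordinates. *)
declare split_paired_All [simp del] split_paired_Ex [simp del]

section \<open>Finite use of the oracle\<close>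

lemma rtranclp_final_unique:
  assumes "\<And>x y z. R x y \<Longrightarrow> R x z \<Longrightarrow> y = z" "R\<^sup>*\<^sup>* a b" "R\<^sup>*\<^sup>* a c" "\<And>d. \<not> R b d" "\<And>d. \<not> R c d"
  shows "b = c"
  using assms(2,3)
proof (induction rule: converse_rtranclp_induct)
  case base
  then show ?case using assms(4) by (metis converse_rtranclpE)
next
  case (step a a')
  from step.prems show ?case
  proof (cases rule: converse_rtranclpE)
    case base
    then show ?thesis using step.hyps(1) assms(5) by blast
  next
    case (step a'')
    then show ?thesis using step.IH \<open>R a a'\<close> assms(1) by metis
  qed
qed

lemma tm_outputs_unique:
  assumes "tm_outputs M \<gamma> n v" "tm_outputs M \<gamma> n v'"
  shows "v = v'"
proof -
  let ?R = "\<lambda>c d. tm_step M \<gamma> c = Some d"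
  obtain q w u where 1: "?R\<^sup>*\<^sup>* (init_state M, unary n, unary 0) (q, w, u)"
    "tm_step M \<gamma> (q, w, u) = None" "v = tape_value w"
    using assms(1) unfolding tm_outputs_def by blast
  obtain q' w' u' where 2: "?R\<^sup>*\<^sup>* (init_state M, unary n, unary 0) (q', w', u')"
    "tm_step M \<gamma> (q', w', u') = None" "v' = tape_value w'"
    using assms(2) unfolding tm_outputs_def by blast
  have "(q, w, u) = (q', w', u')"
    by (rule rtranclp_final_unique[OF _ 1(1) 2(1)]) (use 1(2) 2(2) in auto)
  then show ?thesis using 1 2 by simp
qed

lemma tm_step_finite_use:
  "\<exists>K. \<forall>\<gamma>'. (\<forall>m<K. \<gamma>' m = \<gamma> m) \<longrightarrow> tm_step M \<gamma>' c = tm_step M \<gamma> c"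
proof -
  obtain q w u where c: "c = (q, w, u)" by (cases c)
  show ?thesis unfolding c by (rule exI[of _ "Suc (tape_value u)"]) simp
qed

lemma tm_run_finite_use:
  assumes "(\<lambda>c d. tm_step M \<gamma> c = Some d)\<^sup>*\<^sup>* a b"
  shows "\<exists>K. \<forall>\<gamma>'. (\<forall>m<K. \<gamma>' m = \<gamma> m) \<longrightarrow> (\<lambda>c d. tm_step M \<gamma>' c = Some d)\<^sup>*\<^sup>* a b"
  using assms
proof (induction rule: rtranclp_induct)
  case base
  then show ?case by blast
next
  case (step b c)
  obtain K where K: "\<And>\<gamma>'. \<forall>m<K. \<gamma>' m = \<gamma> m \<Longrightarrow> (\<lambda>c d. tm_step M \<gamma>' c = Some d)\<^sup>*\<^sup>* a b"
    using step.IH by blast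
  obtain L where L: "\<And>\<gamma>'. \<forall>m<L. \<gamma>' m = \<gamma> m \<Longrightarrow> tm_step M \<gamma>' b = tm_step M \<gamma> b"
    using tm_step_finite_use by blast
  show ?case
  proof (intro exI[of _ "max K L"] allI impI)
    fix \<gamma>' assume "\<forall>m<max K L. \<gamma>' m = \<gamma> m"
    then have "(\<lambda>c d. tm_step M \<gamma>' c = Some d)\<^sup>*\<^sup>* a b" "tm_step M \<gamma>' b = Some c"
      using K L step.hyps(2) by simp_all
    then show "(\<lambda>c d. tm_step M \<gamma>' c = Some d)\<^sup>*\<^sup>* a c"
      by (rule rtranclp.rtrancl_into_rtrancl)
  qed
qed

lemma tm_outputs_finite_use:
  assumes "tm_outputs M \<gamma> n v"
  shows "\<exists>K. \<forall>\<gamma>'. (\<forall>m<K. \<gamma>' m = \<gamma> m) \<longrightarrow> tm_outputs M \<gamma>' n v"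
proof -
  obtain q w u where 1: "(\<lambda>c d. tm_step M \<gamma> c = Some d)\<^sup>*\<^sup>* (init_state M, unary n, unary 0) (q, w, u)"
    "tm_step M \<gamma> (q, w, u) = None" "v = tape_value w"
    using assms(1) unfolding tm_outputs_def by blast
  have halt: "tm_step M \<gamma>' (q, w, u) = None" for \<gamma>'
    using 1(2) by (auto split: if_splits)
  show ?thesis using tm_run_finite_use[OF 1(1)] halt 1(3) unfolding tm_outputs_def by blast
qed

lemma sup_norm_le:
  assumes "full_shift A \<noteq> {}" "\<And>x. x \<in> full_shift A \<Longrightarrow> \<bar>f x\<bar> \<le> c"
  shows "sup_norm A f \<le> c"
  unfolding sup_norm_def using assms by (intro cSUP_least) auto

text \<open>A machine that is run on an oracle always answering with a code of \<open>0\<close> halts after finitely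
  many queries. Those answers remain admissible for any function that is small compared with the
  precision asked for, and only later queries need to be answered by a code of that function. The
  machine therefore gives one output for both functions, which approximates both values.\<close>

lemma computable_functional_near_zero:
  fixes f :: "config \<Rightarrow> real"
  assumes comp: "computable_functional A F" and A: "finite A" "A \<noteq> {}"
    and f: "rational_locally_constant A f" "\<And>x. x \<in> full_shift A \<Longrightarrow> \<bar>f x\<bar> \<le> 1"
    and cont: "f \<in> cont_funs A"
  shows "\<exists>K. \<bar>F (\<lambda>x. (1/2) ^ K * f x) - F (\<lambda>x. 0)\<bar> < 2 * (1/2) ^ n"
proof -
  obtain M where M: "\<And>\<phi> \<gamma> n. \<phi> \<in> cont_funs A \<Longrightarrow> oracle_for A \<phi> \<gamma> \<Longrightarrow>
      \<exists>v. tm_outputs M \<gamma> n v \<and> \<bar>of_rat (nat_to_rat_surj v) - F \<phi>\<bar> < (1/2) ^ n"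
    using comp unfolding computable_functional_def by blast
  obtain a where a: "a \<in> A" using A by blast
  then have ne: "full_shift A \<noteq> {}"
    by (auto simp: full_shift_def intro!: exI[of _ "\<lambda>_. a"])
  obtain z where z: "\<And>x. x \<in> full_shift A \<Longrightarrow> loc_const z x = 0"
    using loc_const_exhaustive[OF A(1), of "\<lambda>_. 0"] by (auto simp: rational_locally_constant_def)
  have zero: "oracle_for A (\<lambda>x. 0) (\<lambda>_. z)"
    unfolding oracle_for_def
  proof
    fix m
    have "sup_norm A (\<lambda>x. loc_const z x - 0) \<le> 0"
      using z by (intro sup_norm_le[OF ne]) auto
    then show "sup_norm A (\<lambda>x. loc_const z x - 0) < (1/2) ^ m"
      by (rule order.strict_trans1) simp
  qed
  have "(\<lambda>x. 0) \<in> cont_funs A" by (simp add: cont_funs_def)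
  from M[OF this zero, of n] obtain v where v: "tm_outputs M (\<lambda>_. z) n v"
    "\<bar>of_rat (nat_to_rat_surj v) - F (\<lambda>x. 0)\<bar> < (1/2) ^ n" by blast
  obtain K where K: "\<And>\<gamma>'. \<forall>m<K. \<gamma>' m = z \<Longrightarrow> tm_outputs M \<gamma>' n v"
    using tm_outputs_finite_use[OF v(1)] by blast
  define g where "g = (\<lambda>x. (1/2) ^ K * f x)"
  have "rational_locally_constant A g"
    using f(1) unfolding rational_locally_constant_def g_def
    by (auto intro!: Rats_mult Rats_power)
  then obtain y where y: "\<And>x. x \<in> full_shift A \<Longrightarrow> loc_const y x = g x"
    using loc_const_exhaustive[OF A(1)] by blast
  (* A query below K asks for a precision coarser than (1/2)^K, which the zero function meets. *)
  define \<gamma>' where "\<gamma>' = (\<lambda>m. if m < K then z else y)"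
  have orac: "oracle_for A g \<gamma>'"
    unfolding oracle_for_def
  proof
    fix m
    show "sup_norm A (\<lambda>x. loc_const (\<gamma>' m) x - g x) < (1/2) ^ m"
    proof (cases "m < K")
      case True
      have "sup_norm A (\<lambda>x. loc_const (\<gamma>' m) x - g x) \<le> (1/2) ^ K"
        using True f(2) z
        by (intro sup_norm_le[OF ne]) (auto simp: \<gamma>'_def g_def abs_mult intro!: mult_left_le)
      also have "\<dots> < (1/2::real) ^ m" using True by (intro power_strict_decreasing) auto
      finally show ?thesis .
    next
      case False
      have "sup_norm A (\<lambda>x. loc_const (\<gamma>' m) x - g x) \<le> 0"
        using False y by (intro sup_norm_le[OF ne]) (auto simp: \<gamma>'_def)
      then show ?thesis by (rule order.strict_trans1) simp
    qed
  qed
  have "g \<in> cont_funs A" using cont unfolding cont_funs_def g_def by (auto intro: continuous_intros)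
  from M[OF this orac, of n] obtain v' where v': "tm_outputs M \<gamma>' n v'"
    "\<bar>of_rat (nat_to_rat_surj v') - F g\<bar> < (1/2) ^ n" by blast
  have "tm_outputs M \<gamma>' n v" by (rule K) (simp add: \<gamma>'_def)
  then have eq: "v' = v" using v'(1) tm_outputs_unique by blast
  have "\<bar>F g - F (\<lambda>x. 0)\<bar> < 2 * (1/2) ^ n" using v(2) v'(2)[unfolded eq] by linarith
  then show ?thesis unfolding g_def by blast
qed


section \<open>Entropy of finitely valued observables\<close>

text \<open>A plain finite sum over the attained values: no measure on the value type is involved, and the
  entropy of a partition is literally of this form for the map to its cells.\<close>

definition obs_entropy :: "'a measure \<Rightarrow> ('a \<Rightarrow> 'b) \<Rightarrow> real" where
  "obs_entropy M X = - (\<Sum>v\<in>X ` space M.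
     measure M (X -` {v} \<inter> space M) * ln (measure M (X -` {v} \<inter> space M)))"

text \<open>Values that are not attained contribute \<open>0 * ln 0 = 0\<close>, so the entropies of different measures can
  be written as sums over one common set of values.\<close>

lemma obs_entropy_superset:
  assumes "finite V" "X ` space M \<subseteq> V"
  shows "obs_entropy M X = - (\<Sum>v\<in>V.
     measure M (X -` {v} \<inter> space M) * ln (measure M (X -` {v} \<inter> space M)))"
proof -
  have "X -` {v} \<inter> space M = {}" if "v \<notin> X ` space M" for v
    using that by auto
  then show ?thesis
    unfolding obs_entropy_def using assms
    by (intro arg_cong[where f = uminus] sum.mono_neutral_left) auto
qed

lemma obs_entropy_cong:
  assumes "\<And>x. x \<in> space M \<Longrightarrow> X x = Y x"
  shows "obs_entropy M X = obs_entropy M Y"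
proof -
  have "X ` space M = Y ` space M" "\<And>v. X -` {v} \<inter> space M = Y -` {v} \<inter> space M"
    using assms by (auto simp: image_iff)
  then show ?thesis by (simp add: obs_entropy_def)
qed

lemma factor_through:
  assumes "\<And>x y. x \<in> S \<Longrightarrow> y \<in> S \<Longrightarrow> Y x = Y y \<Longrightarrow> X x = X y"
  shows "\<exists>f. \<forall>x\<in>S. X x = (f \<circ> Y) x"
proof (intro exI ballI)
  fix x assume "x \<in> S"
  then show "X x = ((X \<circ> inv_into S Y) \<circ> Y) x"
    using assms[of x "inv_into S Y (Y x)"] by (simp add: f_inv_into_f inv_into_into)
qed

lemma simple_function_determined:
  assumes "simple_function M Y"
    and "\<And>x y. x \<in> space M \<Longrightarrow> y \<in> space M \<Longrightarrow> Y x = Y y \<Longrightarrow> X x = X y"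
  shows "simple_function M X"
proof -
  obtain f where f: "\<forall>x\<in>space M. X x = (f \<circ> Y) x"
    using factor_through[of "space M" Y X] assms(2) by blast
  show ?thesis
    using simple_function_compose[OF assms(1), of f] simple_function_cong f by metis
qed

lemma simple_function_tuple:
  assumes "finite I" "\<And>i. i \<in> I \<Longrightarrow> simple_function M (X i)"
  shows "simple_function M (\<lambda>x. \<lambda>i\<in>I. X i x)"
  using assms
proof (induction rule: finite_induct)
  case empty
  then show ?case by (simp add: restrict_def)
next
  case (insert i I)
  have "simple_function M (\<lambda>x. \<lambda>i\<in>I. X i x)"
    by (rule insert.IH) (simp add: insert.prems)
  then have "simple_function M (\<lambda>x. (X i x, \<lambda>i\<in>I. X i x))"
    by (intro simple_function_Pair) (simp add: insert.prems)
  then show ?case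
    by (rule simple_function_determined) (auto simp: restrict_def fun_eq_iff, metis)
qed

lemma continuous_on_x_ln_x: "continuous_on {0..} (\<lambda>t::real. t * ln t)"
proof (unfold continuous_on_def, intro ballI)
  fix t :: real assume t: "t \<in> {0..}"
  show "((\<lambda>t. t * ln t) \<longlongrightarrow> t * ln t) (at t within {0..})"
  proof (cases "t = 0")
    case True
    have "((\<lambda>t::real. t * ln t) \<longlongrightarrow> 0) (at_right 0)" by real_asymp
    then show ?thesis using True by (simp add: at_within_Ici_at_right)
  next
    case False
    then have "isCont (\<lambda>t. t * ln t) t" by (intro continuous_intros) auto
    then show ?thesis unfolding isCont_def by (rule tendsto_within_subset) simp
  qed
qed

lemma tendsto_x_ln_x:
  fixes f :: "'a \<Rightarrow> real"
  assumes "(f \<longlongrightarrow> t) F" "\<And>k. 0 \<le> f k" "0 \<le> t"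
  shows "((\<lambda>k. f k * ln (f k)) \<longlongrightarrow> t * ln t) F"
  using continuous_on_tendsto_compose[OF continuous_on_x_ln_x assms(1)] assms(2,3) by simp

context prob_space
begin

lemma obs_entropy_eq_entropy:
  assumes "simple_function M X"
  shows "obs_entropy M X = entropy (exp 1) (count_space (X ` space M)) X"
proof -
  interpret information_space M "exp 1" by unfold_locales simp
  show ?thesis
    unfolding entropy_simple_distributed[OF simple_distributedI[OF assms measure_nonneg refl]]
    by (simp add: obs_entropy_def log_def)
qed

lemma obs_entropy_nonneg: "0 \<le> obs_entropy M X"
  unfolding obs_entropy_def
  by (auto intro!: sum_nonpos mult_nonneg_nonpos simp: ln_le_zero_iff)
     (metis ln_0 ln_le_zero_iff measure_nonneg order.order_iff_strict prob_le_1)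

text \<open>Stated through values that agree, without naming the function, because blocks of letters are
  compared by the sites on which two configurations agree.\<close>

lemma obs_entropy_determined:
  assumes Y: "simple_function M Y"
    and det: "\<And>x y. x \<in> space M \<Longrightarrow> y \<in> space M \<Longrightarrow> Y x = Y y \<Longrightarrow> X x = X y"
  shows "obs_entropy M X \<le> obs_entropy M Y"
proof -
  interpret information_space M "exp 1" by unfold_locales simp
  obtain f where f: "\<forall>x\<in>space M. X x = (f \<circ> Y) x"
    using factor_through[of "space M" Y X] det by blast
  have "obs_entropy M X = obs_entropy M (f \<circ> Y)" by (rule obs_entropy_cong) (use f in blast)
  also have "\<dots> \<le> obs_entropy M Y"
    unfolding obs_entropy_eq_entropy[OF Y] obs_entropy_eq_entropy[OF simple_function_compose[OF Y]]
    by (rule entropy_data_processing[OF Y])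
  finally show ?thesis .
qed

lemma obs_entropy_Pair_le:
  assumes X: "simple_function M X" and Y: "simple_function M Y"
  shows "obs_entropy M (\<lambda>x. (X x, Y x)) \<le> obs_entropy M X + obs_entropy M Y"
proof -
  interpret information_space M "exp 1" by unfold_locales simp
  show ?thesis
    using entropy_chain_rule[OF X Y] conditional_entropy_less_eq_entropy[OF Y X]
    by (simp add: obs_entropy_eq_entropy X Y simple_function_Pair)
qed

lemma obs_entropy_tuple_le:
  assumes "finite I" "\<And>i. i \<in> I \<Longrightarrow> simple_function M (X i)"
  shows "obs_entropy M (\<lambda>x. \<lambda>i\<in>I. X i x) \<le> (\<Sum>i\<in>I. obs_entropy M (X i))"
  using assms
proof (induction rule: finite_induct)
  case empty
  have "(\<lambda>x. \<lambda>i\<in>{}. X i x) ` space M = {\<lambda>_. undefined}"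
    using not_empty by (auto simp: restrict_def)
  then show ?case by (simp add: obs_entropy_def restrict_def prob_space)
next
  case (insert i I)
  have sf: "simple_function M (X i)" "simple_function M (\<lambda>x. \<lambda>i\<in>I. X i x)"
    by (simp_all add: insert.prems simple_function_tuple insert.hyps)
  have "obs_entropy M (\<lambda>x. \<lambda>i\<in>insert i I. X i x) \<le> obs_entropy M (\<lambda>x. (X i x, \<lambda>i\<in>I. X i x))"
    using sf
    by (intro obs_entropy_determined simple_function_Pair) (auto simp: restrict_def fun_eq_iff, metis)
  also have "\<dots> \<le> obs_entropy M (X i) + obs_entropy M (\<lambda>x. \<lambda>i\<in>I. X i x)"
    by (rule obs_entropy_Pair_le[OF sf])
  also have "\<dots> \<le> obs_entropy M (X i) + (\<Sum>i\<in>I. obs_entropy M (X i))"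
    by (intro add_left_mono insert.IH) (simp add: insert.prems)
  finally show ?case by (simp only: sum.insert[OF insert.hyps])
qed

lemma obs_entropy_compose_invariant:
  assumes T: "T \<in> measurable M M" "distr M M T = M" and X: "simple_function M X"
  shows "obs_entropy M (\<lambda>x. X (T x)) = obs_entropy M X"
proof -
  have Tsp: "T x \<in> space M" if "x \<in> space M" for x using T(1) that by (rule measurable_space)
  have "measure M ((\<lambda>x. X (T x)) -` {v} \<inter> space M) = measure M (X -` {v} \<inter> space M)" for v
  proof -
    have "measure M (X -` {v} \<inter> space M) = measure (distr M M T) (X -` {v} \<inter> space M)"
      using T(2) by simp
    also have "\<dots> = measure M (T -` (X -` {v} \<inter> space M) \<inter> space M)"
      by (rule measure_distr[OF T(1) simple_functionD(2)[OF X]])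
    also have "T -` (X -` {v} \<inter> space M) \<inter> space M = (\<lambda>x. X (T x)) -` {v} \<inter> space M"
      using Tsp by auto
    finally show ?thesis by simp
  qed
  moreover have "obs_entropy M (\<lambda>x. X (T x)) = - (\<Sum>v\<in>X ` space M.
     measure M ((\<lambda>x. X (T x)) -` {v} \<inter> space M) * ln (measure M ((\<lambda>x. X (T x)) -` {v} \<inter> space M)))"
    using Tsp simple_functionD(1)[OF X] by (intro obs_entropy_superset) auto
  ultimately show ?thesis by (simp add: obs_entropy_def)
qed

end

text \<open>The binary entropy function tends to \<open>0\<close> at \<open>0\<close>. This controls the cost of replacing the cells
  of a partition by sets that depend on finitely many letters.\<close>

lemma indicator_entropy_small:
  assumes "0 < e"
  shows "\<exists>d>0. \<forall>M D. prob_space M \<longrightarrow> D \<in> sets M \<longrightarrow> measure M D < d \<longrightarrow> obs_entropy M (\<lambda>x. x \<in> D) < e"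
proof -
  define \<eta> where "\<eta> t = - (t * ln t) - ((1 - t) * ln (1 - t))" for t :: real
  have "((\<lambda>t::real. t * ln t) \<longlongrightarrow> 0) (at_right 0)" by real_asymp
  moreover have "((\<lambda>t::real. (1 - t) * ln (1 - t)) \<longlongrightarrow> 0) (at_right 0)" by real_asymp
  ultimately have "(\<eta> \<longlongrightarrow> - 0 - 0) (at_right 0)" unfolding \<eta>_def by (intro tendsto_intros)
  then have "\<forall>\<^sub>F t in at_right 0. \<eta> t < e" using assms by (intro order_tendstoD) auto
  then obtain d where d: "d > 0" "\<And>t. 0 < t \<Longrightarrow> t < d \<Longrightarrow> \<eta> t < e"
    by (auto simp: eventually_at_right_field)
  have "obs_entropy M (\<lambda>x. x \<in> D) < e"
    if M: "prob_space M" and D: "D \<in> sets M" "measure M D < d" for M :: "'a measure" and D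
  proof -
    interpret prob_space M by fact
    have "(\<lambda>x. x \<in> D) -` {True} \<inter> space M = D" "(\<lambda>x. x \<in> D) -` {False} \<inter> space M = space M - D"
      using sets.sets_into_space[OF D(1)] by auto
    then have "obs_entropy M (\<lambda>x. x \<in> D) = \<eta> (measure M D)"
      by (subst obs_entropy_superset[of "{True, False}"]) (auto simp: \<eta>_def prob_compl D(1))
    moreover have "\<eta> (measure M D) < e"
    proof (cases "measure M D = 0")
      case True
      then show ?thesis using assms by (simp add: \<eta>_def)
    next
      case False
      then have "0 < measure M D" using measure_nonneg[of M D] by linarith
      then show ?thesis using d(2) D(2) by blast
    qed
    ultimately show ?thesis by simp
  qed
  then show ?thesis using d(1) by blast
qed


section \<open>Block entropies of an invariant measure\<close>

text \<open>Fekete's lemma for squares. The premise \<open>cover\<close> is what remains of subadditivity when a square of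
  side \<open>n\<close> is covered by at most \<open>(n / m + 1)\<^sup>2\<close> squares of side \<open>m\<close>; dividing by \<open>n\<^sup>2\<close> leaves the
  factor \<open>(1 / m + 1 / n)\<^sup>2\<close>, which tends to \<open>1 / m\<^sup>2\<close>.\<close>

lemma square_averages_tendsto_Inf:
  fixes a :: "nat \<Rightarrow> real"
  assumes nonneg: "\<And>n. 0 \<le> a n"
    and cover: "\<And>m n. 0 < m \<Longrightarrow> 0 < n \<Longrightarrow> a n \<le> (real n / real m + 1)\<^sup>2 * a m"
  shows "\<exists>L. (\<lambda>n. a n / (real n)\<^sup>2) \<longlonglongrightarrow> L \<and> (\<forall>m>0. L \<le> a m / (real m)\<^sup>2)"
proof -
  define L where "L = (INF m\<in>{0<..}. a m / (real m)\<^sup>2)"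
  have bdd: "bdd_below ((\<lambda>m. a m / (real m)\<^sup>2) ` {0<..})"
    using nonneg by (intro bdd_belowI[of _ 0]) auto
  have L: "L \<le> a m / (real m)\<^sup>2" if "0 < m" for m
    unfolding L_def by (rule cINF_lower[OF bdd]) (use that in simp)
  have "(\<lambda>n. a n / (real n)\<^sup>2) \<longlonglongrightarrow> L"
  proof (rule order_tendstoI)
    fix y assume "y < L"
    show "\<forall>\<^sub>F n in sequentially. y < a n / (real n)\<^sup>2"
      using eventually_gt_at_top[of "0::nat"]
    proof eventually_elim
      case (elim n)
      then show ?case using L[of n] \<open>y < L\<close> by linarith
    qed
  next
    fix y assume "L < y"
    then obtain m where m: "0 < m" "a m / (real m)\<^sup>2 < y"
      unfolding L_def by (subst (asm) cINF_less_iff[OF _ bdd]) auto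
    have "(\<lambda>n. (1 / real m + 1 / real n)\<^sup>2 * a m) \<longlonglongrightarrow> (1 / real m + 0)\<^sup>2 * a m"
      by (intro tendsto_intros lim_1_over_n)
    then have "\<forall>\<^sub>F n in sequentially. (1 / real m + 1 / real n)\<^sup>2 * a m < y"
      by (rule order_tendstoD) (use m in \<open>simp add: power_divide\<close>)
    then show "\<forall>\<^sub>F n in sequentially. a n / (real n)\<^sup>2 < y"
      using eventually_gt_at_top[of "0::nat"]
    proof eventually_elim
      case (elim n)
      have "a n / (real n)\<^sup>2 \<le> (real n / real m + 1)\<^sup>2 * a m / (real n)\<^sup>2"
        using cover[OF m(1) elim(2)] by (intro divide_right_mono) auto
      also have "\<dots> = ((real n / real m + 1) / real n)\<^sup>2 * a m" by (simp add: power_divide)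
      also have "(real n / real m + 1) / real n = 1 / real m + 1 / real n"
        using elim(2) by (simp add: add_divide_distrib)
      finally show ?case using elim(1) by linarith
    qed
  qed
  then show ?thesis using L by blast
qed

lemma shift_shift: "shift g (shift h x) = shift (g + h) x"
  by (simp add: shift_def algebra_simps)

lemma continuous_on_coordinate: "continuous_on S (\<lambda>x::config. x g)"
  by (rule continuous_on_subset[OF continuous_on_product_coordinates]) simp

lemma continuous_on_shift: "continuous_on S (shift g)"
  unfolding shift_def by (intro continuous_on_coordinatewise_then_product continuous_on_coordinate)

lemma shift_measurable_full_shift:
  "shift g \<in> measurable (restrict_space borel (full_shift A)) (restrict_space borel (full_shift A))"
proof (rule measurable_restrict_space3)
  show "shift g \<in> borel_measurable borel"
    by (intro borel_measurable_continuous_onI continuous_on_shift)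
qed (auto simp: full_shift_def shift_def)

definition block :: "(config \<Rightarrow> 'b) \<Rightarrow> (int \<times> int) set \<Rightarrow> config \<Rightarrow> int \<times> int \<Rightarrow> 'b" where
  "block X F x = (\<lambda>g\<in>F. X (shift g x))"

abbreviation letter :: "config \<Rightarrow> nat" where
  "letter x \<equiv> x 0"

lemma letter_shift: "letter (shift g x) = x g"
  by (simp add: shift_def)

lemma block_eq_iff: "block X F x = block X F y \<longleftrightarrow> (\<forall>g\<in>F. X (shift g x) = X (shift g y))"
  by (auto simp: block_def restrict_def fun_eq_iff) 

locale invariant_measure =
  fixes A :: "nat set" and \<mu> :: "config measure"
  assumes finite_alphabet: "finite A" and nonempty_alphabet: "A \<noteq> {}"
    and invariant: "\<mu> \<in> inv_measures A"
begin

lemma prob_space_measure: "prob_space \<mu>"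
  and space_measure: "space \<mu> = full_shift A"
  and sets_measure: "sets \<mu> = sets (restrict_space borel (full_shift A))"
  and distr_shift: "distr \<mu> \<mu> (shift g) = \<mu>"
  using invariant by (auto simp: inv_measures_def)

sublocale prob_space \<mu> by (rule prob_space_measure)

lemma shift_measurable: "shift g \<in> measurable \<mu> \<mu>"
  using shift_measurable_full_shift[of g A] measurable_cong_sets[OF sets_measure sets_measure] by simp

lemma continuous_measurable:
  fixes f :: "config \<Rightarrow> 'b::topological_space"
  assumes "continuous_on (full_shift A) f"
  shows "f \<in> borel_measurable \<mu>"
  using borel_measurable_continuous_on_restrict[OF assms] measurable_cong_sets[OF sets_measure refl] by blast

lemma simple_function_letter: "simple_function \<mu> letter"
  unfolding simple_function_def
proof (intro conjI ballI)
  show "finite (letter ` space \<mu>)"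
    by (rule finite_subset[OF _ finite_alphabet]) (auto simp: space_measure full_shift_def)
  fix a
  have "letter \<in> borel_measurable \<mu>"
    by (intro continuous_measurable continuous_on_coordinate)
  then show "letter -` {a} \<inter> space \<mu> \<in> sets \<mu>"
    by (rule measurable_sets) (simp add: borel_closed)
qed

lemma simple_function_shift:
  assumes "simple_function \<mu> X"
  shows "simple_function \<mu> (\<lambda>x. X (shift g x))"
proof -
  have sp: "shift g x \<in> space \<mu>" if "x \<in> space \<mu>" for x
    using measurable_space[OF shift_measurable that] .
  have "finite ((\<lambda>x. X (shift g x)) ` space \<mu>)"
    using sp by (intro finite_subset[OF _ simple_functionD(1)[OF assms]]) auto
  moreover have "(\<lambda>x. X (shift g x)) -` {v} \<inter> space \<mu> \<in> sets \<mu>" for v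
  proof -
    have "(\<lambda>x. X (shift g x)) -` {v} \<inter> space \<mu> = shift g -` (X -` {v} \<inter> space \<mu>) \<inter> space \<mu>"
      using sp by auto
    then show ?thesis
      using measurable_sets[OF shift_measurable simple_functionD(2)[OF assms]] by simp
  qed
  ultimately show ?thesis unfolding simple_function_def by blast
qed

lemma simple_function_block:
  assumes "simple_function \<mu> X" "finite F"
  shows "simple_function \<mu> (block X F)"
  unfolding block_def[abs_def]
  using assms by (intro simple_function_tuple simple_function_shift)

lemma entropy_shift:
  assumes "simple_function \<mu> X"
  shows "obs_entropy \<mu> (\<lambda>x. X (shift g x)) = obs_entropy \<mu> X"
  by (rule obs_entropy_compose_invariant[OF shift_measurable distr_shift assms])

lemma block_entropy_mono:
  assumes "simple_function \<mu> X" "finite G" "F \<subseteq> G"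
  shows "obs_entropy \<mu> (block X F) \<le> obs_entropy \<mu> (block X G)"
  using assms by (intro obs_entropy_determined simple_function_block) (auto simp: block_eq_iff)

lemma block_entropy_translate:
  assumes X: "simple_function \<mu> X" and F: "finite F"
  shows "obs_entropy \<mu> (block X ((\<lambda>g. g + h) ` F)) = obs_entropy \<mu> (block X F)"
proof -
  have sf: "simple_function \<mu> (block X F)" "simple_function \<mu> (block X ((\<lambda>g. g + h) ` F))"
    using X F by (auto intro: simple_function_block)
  have eq: "block X F (shift h x) = block X F (shift h y) \<longleftrightarrow>
      block X ((\<lambda>g. g + h) ` F) x = block X ((\<lambda>g. g + h) ` F) y" for x y
    by (auto simp: block_eq_iff shift_shift)
  have "obs_entropy \<mu> (block X ((\<lambda>g. g + h) ` F)) = obs_entropy \<mu> (\<lambda>x. block X F (shift h x))"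
    using eq sf by (intro antisym obs_entropy_determined simple_function_shift) auto
  also have "\<dots> = obs_entropy \<mu> (block X F)" by (rule entropy_shift[OF sf(1)])
  finally show ?thesis .
qed

lemma block_entropy_UN_le:
  assumes "finite I" "\<And>i. i \<in> I \<Longrightarrow> finite (F i)" "simple_function \<mu> X"
  shows "obs_entropy \<mu> (block X (\<Union>i\<in>I. F i)) \<le> (\<Sum>i\<in>I. obs_entropy \<mu> (block X (F i)))"
proof -
  have "obs_entropy \<mu> (block X (\<Union>i\<in>I. F i)) \<le> obs_entropy \<mu> (\<lambda>x. \<lambda>i\<in>I. block X (F i) x)"
  proof (intro obs_entropy_determined simple_function_tuple simple_function_block assms)
    fix x y assume eq: "(\<lambda>i\<in>I. block X (F i) x) = (\<lambda>i\<in>I. block X (F i) y)"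
    have "block X (F i) x = block X (F i) y" if "i \<in> I" for i
      using fun_cong[OF eq, of i] that by simp
    then show "block X (\<Union>i\<in>I. F i) x = block X (\<Union>i\<in>I. F i) y" by (auto simp: block_eq_iff)
  qed
  also have "\<dots> \<le> (\<Sum>i\<in>I. obs_entropy \<mu> (block X (F i)))"
    using assms by (intro obs_entropy_tuple_le simple_function_block)
  finally show ?thesis .
qed

lemma finite_box: "finite (box n)"
  by (simp add: box_def)

lemma block_entropy_box_cover:
  assumes X: "simple_function \<mu> X" and m: "0 < m"
  shows "obs_entropy \<mu> (block X (box n)) \<le> (real n / real m + 1)\<^sup>2 * obs_entropy \<mu> (block X (box m))"
proof -
  define T where "T i = (\<lambda>g. g + (int m * fst i, int m * snd i)) ` box m" for i :: "int \<times> int"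
  (* Rounding up the number of squares per side avoids a separate treatment of the remainder. *)
  define q where "q = Suc (n div m)"
  have "box n \<subseteq> (\<Union>i\<in>box q. T i)"
  proof (rule subrelI)
    fix r s assume "(r, s) \<in> box n"
    then have rs: "0 \<le> r" "r < int n" "0 \<le> s" "s < int n" by (auto simp: box_def)
    have quot: "t div int m < int q" if "t < int n" for t
    proof -
      have "t div int m \<le> int n div int m" using that m by (intro zdiv_mono1) auto
      then show ?thesis by (simp add: q_def zdiv_int)
    qed
    have "(r, s) = (r mod int m, s mod int m) + (int m * (r div int m), int m * (s div int m))"
      by simp
    moreover have "(r mod int m, s mod int m) \<in> box m" using m by (simp add: box_def)
    ultimately have "(r, s) \<in> T (r div int m, s div int m)"
      unfolding T_def by (metis (no_types, lifting) fst_conv image_eqI snd_conv)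
    moreover have "(r div int m, s div int m) \<in> box q"
      using rs quot m by (auto simp: box_def pos_imp_zdiv_nonneg_iff)
    ultimately show "(r, s) \<in> (\<Union>i\<in>box q. T i)" by blast
  qed
  then have "obs_entropy \<mu> (block X (box n)) \<le> obs_entropy \<mu> (block X (\<Union>i\<in>box q. T i))"
    using X by (intro block_entropy_mono) (auto simp: T_def finite_box)
  also have "\<dots> \<le> (\<Sum>i\<in>box q. obs_entropy \<mu> (block X (T i)))"
    using X by (intro block_entropy_UN_le) (auto simp: T_def finite_box)
  also have "\<dots> = (\<Sum>i\<in>box q. obs_entropy \<mu> (block X (box m)))"
    unfolding T_def by (intro sum.cong refl block_entropy_translate X finite_box)
  also have "\<dots> = (real q)\<^sup>2 * obs_entropy \<mu> (block X (box m))"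
    by (simp add: box_def card_cartesian_product power2_eq_square)
  also have "\<dots> \<le> (real n / real m + 1)\<^sup>2 * obs_entropy \<mu> (block X (box m))"
  proof (intro mult_right_mono power_mono obs_entropy_nonneg)
    show "real q \<le> real n / real m + 1"
      by (simp add: q_def of_nat_div_le_of_nat)
  qed simp
  finally show ?thesis .
qed

definition obs_rate :: "(config \<Rightarrow> 'b) \<Rightarrow> real" where
  "obs_rate X = lim (\<lambda>n. obs_entropy \<mu> (block X (box n)) / (real n)\<^sup>2)"

lemma obs_rate:
  assumes "simple_function \<mu> X"
  shows obs_rate_tendsto: "(\<lambda>n. obs_entropy \<mu> (block X (box n)) / (real n)\<^sup>2) \<longlonglongrightarrow> obs_rate X"
    and obs_rate_le: "0 < m \<Longrightarrow> obs_rate X \<le> obs_entropy \<mu> (block X (box m)) / (real m)\<^sup>2"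
proof -
  obtain L where L: "(\<lambda>n. obs_entropy \<mu> (block X (box n)) / (real n)\<^sup>2) \<longlonglongrightarrow> L"
      "\<forall>m>0. L \<le> obs_entropy \<mu> (block X (box m)) / (real m)\<^sup>2"
    using square_averages_tendsto_Inf[of "\<lambda>n. obs_entropy \<mu> (block X (box n))"]
      obs_entropy_nonneg block_entropy_box_cover[OF assms] by blast
  then have "obs_rate X = L" unfolding obs_rate_def by (intro limI) auto
  then show "(\<lambda>n. obs_entropy \<mu> (block X (box n)) / (real n)\<^sup>2) \<longlonglongrightarrow> obs_rate X"
    "0 < m \<Longrightarrow> obs_rate X \<le> obs_entropy \<mu> (block X (box m)) / (real m)\<^sup>2"
    using L by auto
qed

end


section \<open>The letters generate the entropy\<close>

definition cell :: "'a set set \<Rightarrow> 'a \<Rightarrow> 'a set" where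
  "cell P x = (THE p. p \<in> P \<and> x \<in> p)"

lemma cell_eq_iff:
  assumes P: "partition_on S P" and "x \<in> S" "p \<in> P"
  shows "cell P x = p \<longleftrightarrow> x \<in> p"
proof -
  obtain q where q: "q \<in> P" "x \<in> q" using P \<open>x \<in> S\<close> by (auto simp: partition_on_def)
  have uniq: "r = q" if "r \<in> P" "x \<in> r" for r
    using disjointD[OF partition_onD2[OF P] that(1) q(1)] that(2) q(2) by blast
  have "cell P x = q" unfolding cell_def by (rule the_equality) (use q uniq in blast)+
  then show ?thesis using q uniq[OF assms(3)] by auto
qed

lemma cell_in:
  assumes P: "partition_on S P" and "x \<in> S"
  shows "cell P x \<in> P"
proof -
  obtain q where q: "q \<in> P" "x \<in> q" using P \<open>x \<in> S\<close> by (auto simp: partition_on_def)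
  then have "cell P x = q" using cell_eq_iff[OF P \<open>x \<in> S\<close>] by simp
  then show ?thesis using q by simp
qed

definition determined_on :: "nat set \<Rightarrow> (int \<times> int) set \<Rightarrow> config set \<Rightarrow> bool" where
  "determined_on A E C \<longleftrightarrow> C \<subseteq> full_shift A \<and>
     (\<forall>x\<in>full_shift A. \<forall>y\<in>full_shift A. (\<forall>g\<in>E. x g = y g) \<longrightarrow> (x \<in> C \<longleftrightarrow> y \<in> C))"

lemma determined_onI:
  assumes "C \<subseteq> full_shift A"
    and "\<And>x y. x \<in> full_shift A \<Longrightarrow> y \<in> full_shift A \<Longrightarrow> (\<And>g. g \<in> E \<Longrightarrow> x g = y g) \<Longrightarrow> x \<in> C \<Longrightarrow> y \<in> C"
  shows "determined_on A E C"
  unfolding determined_on_def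
proof (intro conjI ballI impI iffI)
  fix x y assume xy: "x \<in> full_shift A" "y \<in> full_shift A" "\<forall>g\<in>E. x g = y g"
  show "y \<in> C" if "x \<in> C" by (rule assms(2)[OF xy(1,2) _ that]) (use xy(3) in simp)
  show "x \<in> C" if "y \<in> C" by (rule assms(2)[OF xy(2,1) _ that]) (use xy(3) in simp)
qed (rule assms(1))

lemma determined_onD:
  assumes "determined_on A E C" "x \<in> full_shift A" "y \<in> full_shift A" "\<And>g. g \<in> E \<Longrightarrow> x g = y g"
  shows "x \<in> C \<longleftrightarrow> y \<in> C"
  using assms unfolding determined_on_def by blast

lemma determined_on_subset: "determined_on A E C \<Longrightarrow> C \<subseteq> full_shift A"
  by (simp add: determined_on_def)

context invariant_measure
begin

lemma determined_on_measurable: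
  assumes E: "finite E" and C: "determined_on A E C"
  shows "C \<in> sets \<mu>"
proof -
  have "simple_function \<mu> (\<lambda>x. x \<in> C)"
  proof (rule simple_function_determined)
    show "simple_function \<mu> (block letter E)"
      using E by (intro simple_function_block simple_function_letter)
    show "(x \<in> C) = (y \<in> C)" if "x \<in> space \<mu>" "y \<in> space \<mu>" "block letter E x = block letter E y" for x y
      using that by (intro determined_onD[OF C]) (simp_all add: block_eq_iff letter_shift space_measure)
  qed
  then have "(\<lambda>x. x \<in> C) -` {True} \<inter> space \<mu> \<in> sets \<mu>" by (rule simple_functionD(2))
  moreover have "(\<lambda>x. x \<in> C) -` {True} \<inter> space \<mu> = C"
    using determined_on_subset[OF C] by (auto simp: space_measure)
  ultimately show ?thesis by simp
qed

text \<open>The sets that can be approximated in this way form a sigma-algebra: complements are immediate,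
  and a countable union is first replaced by a finite one, whose approximations are again determined
  by finitely many letters.\<close>

lemma sets_approx_by_determined:
  assumes "D \<in> sets \<mu>" "0 < e"
  shows "\<exists>E C. finite E \<and> determined_on A E C \<and> measure \<mu> (sym_diff D C) < e"
proof -
  let ?G = "{{x \<in> UNIV \<rightarrow>\<^sub>E UNIV. x g \<in> B} | (g :: int \<times> int) (B :: nat set). g \<in> UNIV \<and> B \<in> sets borel}"
  have "sets borel = sigma_sets (UNIV \<rightarrow>\<^sub>E UNIV) ?G"
    using sets_PiM_equal_borel[where 'a = "int \<times> int" and 'b = nat]
      sets_PiM_single[of "UNIV :: (int \<times> int) set" "\<lambda>_. borel :: nat measure"]
    by simp
  then obtain B where B: "B \<in> sigma_sets (UNIV \<rightarrow>\<^sub>E UNIV) ?G" "D = full_shift A \<inter> B"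
    using assms(1) by (auto simp: sets_measure sets_restrict_space)
  have meas: "full_shift A \<inter> B \<in> sets \<mu>" if "B \<in> sigma_sets (UNIV \<rightarrow>\<^sub>E UNIV) ?G" for B
    using that \<open>sets borel = _\<close> by (auto simp: sets_measure sets_restrict_space)
  have "\<exists>E C. finite E \<and> determined_on A E C \<and> measure \<mu> (sym_diff (full_shift A \<inter> B) C) < e"
    using B(1) assms(2)
  proof (induction arbitrary: e rule: sigma_sets.induct)
    case (Basic B)
    then obtain g S where B: "B = {x \<in> UNIV \<rightarrow>\<^sub>E UNIV. x g \<in> S}" by blast
    have "determined_on A {g} (full_shift A \<inter> B)" by (rule determined_onI) (simp_all add: B)
    then show ?case using Basic.prems by (intro exI[of _ "{g}"] exI[of _ "full_shift A \<inter> B"]) auto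
  next
    case Empty
    have "determined_on A {} {}" by (rule determined_onI) simp_all
    then show ?case using Empty.prems by (intro exI[of _ "{}"]) simp
  next
    case (Compl B)
    obtain E C where EC: "finite E" "determined_on A E C" "measure \<mu> (sym_diff (full_shift A \<inter> B) C) < e"
      using Compl.IH[OF Compl.prems] by blast
    have "determined_on A E (full_shift A - C)"
      by (rule determined_onI) (use determined_onD[OF EC(2)] in blast)+
    moreover have "sym_diff (full_shift A \<inter> ((UNIV \<rightarrow>\<^sub>E UNIV) - B)) (full_shift A - C) =
        sym_diff (full_shift A \<inter> B) C"
      using determined_on_subset[OF EC(2)] by auto
    ultimately show ?case using EC by metis
  next
    case (Union B)
    define B' where "B' n = full_shift A \<inter> B n" for n
    have mB: "B' n \<in> sets \<mu>" for n unfolding B'_def using meas Union.hyps by blast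
    have "(\<lambda>n. measure \<mu> (\<Union>i<n. B' i)) \<longlonglongrightarrow> measure \<mu> (\<Union>n. \<Union>i<n. B' i)"
      using mB by (intro finite_Lim_measure_incseq) (auto simp: incseq_def intro: order.strict_trans2)
    also have "(\<Union>n. \<Union>i<n. B' i) = (\<Union>n. B' n)" by auto
    finally have "\<forall>\<^sub>F n in sequentially. measure \<mu> (\<Union>n. B' n) - e / 2 < measure \<mu> (\<Union>i<n. B' i)"
      using Union.prems by (intro order_tendstoD) auto
    then obtain N where N: "measure \<mu> (\<Union>n. B' n) - e / 2 < measure \<mu> (\<Union>i<N. B' i)"
      by (auto simp: eventually_sequentially)
    have "\<exists>E C. finite E \<and> determined_on A E C \<and> measure \<mu> (sym_diff (B' i) C) < e / (2 * real (Suc N))" for i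
      unfolding B'_def using Union.prems by (intro Union.IH) auto
    then obtain E C where EC: "\<And>i. finite (E i)" "\<And>i. determined_on A (E i) (C i)"
      "\<And>i. measure \<mu> (sym_diff (B' i) (C i)) < e / (2 * real (Suc N))" by metis
    have mC: "C i \<in> sets \<mu>" for i using EC by (intro determined_on_measurable)
    let ?C = "\<Union>i<N. C i" and ?E = "\<Union>i<N. E i"
    have det: "determined_on A ?E ?C"
    proof (rule determined_onI)
      show "?C \<subseteq> full_shift A" using determined_on_subset[OF EC(2)] by blast
      fix x y assume xy: "x \<in> full_shift A" "y \<in> full_shift A" "\<And>g. g \<in> ?E \<Longrightarrow> x g = y g"
        and "x \<in> ?C"
      then obtain i where i: "i < N" "x \<in> C i" by blast
      have "x \<in> C i \<longleftrightarrow> y \<in> C i" using i(1) by (intro determined_onD[OF EC(2)] xy) blast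
      then show "y \<in> ?C" using i by blast
    qed
    have "measure \<mu> (sym_diff (\<Union>n. B' n) ?C) \<le>
        measure \<mu> (((\<Union>n. B' n) - (\<Union>i<N. B' i)) \<union> (\<Union>i<N. sym_diff (B' i) (C i)))"
      using mB mC by (intro finite_measure_mono) auto
    also have "\<dots> \<le> measure \<mu> ((\<Union>n. B' n) - (\<Union>i<N. B' i)) + measure \<mu> (\<Union>i<N. sym_diff (B' i) (C i))"
      using mB mC by (intro measure_Un_le) auto
    also have "measure \<mu> ((\<Union>n. B' n) - (\<Union>i<N. B' i)) = measure \<mu> (\<Union>n. B' n) - measure \<mu> (\<Union>i<N. B' i)"
      using mB by (intro finite_measure_Diff) auto
    also have "\<dots> + measure \<mu> (\<Union>i<N. sym_diff (B' i) (C i)) < e / 2 + e / 2"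
    proof (rule add_less_le_mono)
      have "measure \<mu> (\<Union>i<N. sym_diff (B' i) (C i)) \<le> (\<Sum>i<N. measure \<mu> (sym_diff (B' i) (C i)))"
        using mB mC by (intro measure_UNION_le) auto
      also have "\<dots> \<le> (\<Sum>i<N. e / (2 * real (Suc N)))"
        using EC(3) by (intro sum_mono less_imp_le)
      also have "\<dots> \<le> e / 2" using Union.prems by (simp add: field_simps)
      finally show "measure \<mu> (\<Union>i<N. sym_diff (B' i) (C i)) \<le> e / 2" .
    qed (use N in simp)
    finally have "measure \<mu> (sym_diff (\<Union>n. B' n) ?C) < e" by simp
    moreover have "(\<Union>n. B' n) = full_shift A \<inter> (\<Union>n. B n)" unfolding B'_def by blast
    moreover have "finite ?E" using EC(1) by blast
    ultimately show ?case using det by metis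
  qed
  then show ?thesis using B(2) by simp
qed

lemma simple_function_cell:
  assumes "finite_partition \<mu> P"
  shows "simple_function \<mu> (cell P)"
proof -
  have P: "finite P" "P \<subseteq> sets \<mu>" "partition_on (space \<mu>) P"
    using assms by (auto simp: finite_partition_def)
  have fin: "finite (cell P ` space \<mu>)"
    by (rule finite_subset[OF _ P(1)]) (use cell_in[OF P(3)] in auto)
  moreover have "cell P -` {p} \<inter> space \<mu> \<in> sets \<mu>" if "p \<in> cell P ` space \<mu>" for p
  proof -
    have p: "p \<in> P" using that cell_in[OF P(3)] by auto
    have "cell P -` {p} \<inter> space \<mu> = p"
      using cell_eq_iff[OF P(3) _ p] P(2) p sets.sets_into_space by blast
    then show ?thesis using P(2) p by auto
  qed
  ultimately show ?thesis by (simp add: simple_function_def)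
qed

lemma shift_in_space: "x \<in> space \<mu> \<Longrightarrow> shift g x \<in> space \<mu>"
  by (rule measurable_space[OF shift_measurable])

text \<open>The atoms of the refinement are the nonempty level sets of the map that records, for every site of
  \<open>F\<close>, the cell visited there.\<close>

lemma partition_entropy_refine:
  assumes "finite_partition \<mu> P"
  shows "partition_entropy \<mu> (refine \<mu> F P) = obs_entropy \<mu> (block (cell P) F)"
proof -
  have P: "finite P" "P \<subseteq> sets \<mu>" "partition_on (space \<mu>) P"
    using assms by (auto simp: finite_partition_def)
  let ?X = "block (cell P) F"
  let ?V = "?X ` space \<mu>" and ?f = "\<lambda>v. ?X -` {v} \<inter> space \<mu>"
  have VF: "?V \<subseteq> F \<rightarrow>\<^sub>E P"
    using cell_in[OF P(3) shift_in_space] by (auto simp: block_def)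
  have atom: "{x \<in> space \<mu>. \<forall>g\<in>F. shift g x \<in> c g} = ?f c" if c: "c \<in> F \<rightarrow>\<^sub>E P" for c
  proof -
    have "(\<forall>g\<in>F. shift g x \<in> c g) \<longleftrightarrow> ?X x = c" if x: "x \<in> space \<mu>" for x
    proof -
      have "(\<forall>g\<in>F. shift g x \<in> c g) \<longleftrightarrow> (\<forall>g\<in>F. ?X x g = c g)"
        using cell_eq_iff[OF P(3) shift_in_space[OF x]] PiE_mem[OF c]
        by (auto simp: block_def)
      also have "\<dots> \<longleftrightarrow> ?X x = c"
        using c by (auto simp: block_def intro: PiE_ext extensionalityI simp: PiE_iff extensional_def)
      finally show ?thesis .
    qed
    then show ?thesis by auto
  qed
  have "refine \<mu> F P = ?f ` (F \<rightarrow>\<^sub>E P) - {{}}"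
    unfolding refine_def using atom by (intro arg_cong2[where f = minus] image_cong) auto
  also have "\<dots> = ?f ` ?V" using VF by auto
  finally have "refine \<mu> F P = ?f ` ?V" .
  moreover have "inj_on ?f ?V" by (auto simp: inj_on_def)
  ultimately show ?thesis
    by (simp add: partition_entropy_def obs_entropy_def sum.reindex)
qed

lemma entropy_rate_eq_obs_rate:
  assumes "finite_partition \<mu> P"
  shows "entropy_rate \<mu> P = obs_rate (cell P)"
  by (simp add: entropy_rate_def obs_rate_def partition_entropy_refine[OF assms])

text \<open>The Kolmogorov--Sinai theorem for the letters. Approximate each cell \<open>p\<close> by a set \<open>C p\<close> that depends
  on the letters in a window of radius \<open>m\<close>, with a rare error event \<open>D p\<close>. The cells visited in a square
  of side \<open>n\<close> are then a function of the letters in the concentric square of side \<open>n + 2 * m\<close> and of the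
  error indicators at the \<open>n\<^sup>2\<close> sites. Each of these indicators has small entropy, and enlarging the
  square by a fixed margin does not change the rate.\<close>

lemma obs_rate_cell_le_letter:
  assumes "finite_partition \<mu> P"
  shows "obs_rate (cell P) \<le> obs_rate letter"
proof (rule field_le_epsilon)
  have P: "finite P" "P \<subseteq> sets \<mu>" "partition_on (space \<mu>) P"
    using assms by (auto simp: finite_partition_def)
  fix e :: real assume e: "0 < e"
  (* At each site there are card P error indicators, which share the allowance e. *)
  define e' where "e' = e / real (Suc (card P))"
  have "0 < e'" using e by (simp add: e'_def)
  then obtain d where d: "d > 0" "\<And>D. D \<in> sets \<mu> \<Longrightarrow> measure \<mu> D < d \<Longrightarrow> obs_entropy \<mu> (\<lambda>x. x \<in> D) < e'"
    using indicator_entropy_small[of e'] prob_space_measure by blast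
  have "\<forall>p\<in>P. \<exists>E C. finite E \<and> determined_on A E C \<and> measure \<mu> (sym_diff p C) < d"
    using P(2) d(1) sets_approx_by_determined by blast
  then obtain E C where EC: "\<And>p. p \<in> P \<Longrightarrow> finite (E p)" "\<And>p. p \<in> P \<Longrightarrow> determined_on A (E p) (C p)"
    "\<And>p. p \<in> P \<Longrightarrow> measure \<mu> (sym_diff p (C p)) < d"
    by metis
  define D where "D p = sym_diff p (C p)" for p
  have D: "D p \<in> sets \<mu>" if "p \<in> P" for p
    unfolding D_def using P(2) that determined_on_measurable[OF EC(1)[OF that] EC(2)[OF that]] by auto
  have HD: "obs_entropy \<mu> (\<lambda>x. x \<in> D p) \<le> e'" if "p \<in> P" for p
    using d(2)[OF D[OF that]] EC(3)[OF that] by (simp add: D_def)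
  have sfD: "simple_function \<mu> (\<lambda>x. x \<in> D p)" if "p \<in> P" for p
  proof -
    have "(\<lambda>x. x \<in> D p) -` {v} \<inter> space \<mu> = (if v then D p else space \<mu> - D p)" for v
      using sets.sets_into_space[OF D[OF that]] by auto
    then show ?thesis using D[OF that] by (auto simp: simple_function_def)
  qed
  have "finite (\<Union>p\<in>P. E p)" using P(1) EC(1) by blast
  then have "finite ((\<lambda>g. nat \<bar>fst g\<bar> + nat \<bar>snd g\<bar>) ` (\<Union>p\<in>P. E p))" by (rule finite_imageI)
  then obtain m where "\<forall>k\<in>(\<lambda>g. nat \<bar>fst g\<bar> + nat \<bar>snd g\<bar>) ` (\<Union>p\<in>P. E p). k < m"
    using finite_nat_set_iff_bounded by blast
  then have m: "\<bar>fst g\<bar> < int m \<and> \<bar>snd g\<bar> < int m" if "p \<in> P" "g \<in> E p" for p g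
    using that by force
  let ?a = "\<lambda>n. obs_entropy \<mu> (block letter (box n))"
  let ?b = "\<lambda>n. obs_entropy \<mu> (block (cell P) (box n))"
  have bound: "?b n \<le> ?a (n + 2 * m) + (real n)\<^sup>2 * e" for n
  proof -
    define S where "S = (\<lambda>g. g + (- int m, - int m)) ` box (n + 2 * m)"
    define Z where "Z i x = (shift (fst i) x \<in> D (snd i))" for i x
    have S: "k + g \<in> S" if "g \<in> box n" "p \<in> P" "k \<in> E p" for k g p
    proof -
      have "k + g + (int m, int m) \<in> box (n + 2 * m)"
        using that(1) m[OF that(2,3)] by (cases k; cases g) (auto simp: box_def)
      then show ?thesis unfolding S_def
        by (intro image_eqI[of _ _ "k + g + (int m, int m)"]) (cases k; cases g; auto)+
    qed
    have finS: "finite S" by (simp add: S_def finite_box)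
    have finI: "finite (box n \<times> P)" using P(1) finite_box by simp
    have sfZ: "simple_function \<mu> (Z i)" if "i \<in> box n \<times> P" for i
      unfolding Z_def[abs_def] using that by (intro simple_function_shift[of "\<lambda>x. x \<in> D (snd i)"] sfD) auto
    have "?b n \<le> obs_entropy \<mu> (\<lambda>x. (block letter S x, \<lambda>i\<in>box n \<times> P. Z i x))"
    proof (rule obs_entropy_determined)
      show "simple_function \<mu> (\<lambda>x. (block letter S x, \<lambda>i\<in>box n \<times> P. Z i x))"
        using finS finI sfZ
        by (intro simple_function_Pair simple_function_block simple_function_letter simple_function_tuple)
      fix x y assume x: "x \<in> space \<mu>" and y: "y \<in> space \<mu>"
        and eq: "(block letter S x, \<lambda>i\<in>box n \<times> P. Z i x) = (block letter S y, \<lambda>i\<in>box n \<times> P. Z i y)"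
      have xy: "x s = y s" if "s \<in> S" for s
        using eq that by (auto simp: block_eq_iff letter_shift)
      have "(\<lambda>i\<in>box n \<times> P. Z i x) = (\<lambda>i\<in>box n \<times> P. Z i y)"
        using eq by (rule Pair_inject)
      from fun_cong[OF this] have Zxy: "Z i x = Z i y" if "i \<in> box n \<times> P" for i
        using that by (metis (no_types, lifting) restrict_apply')
      have "cell P (shift g x) = cell P (shift g y)" if g: "g \<in> box n" for g
      proof -
        (* Outside the error event a cell and its approximation agree, inside it they disagree. *)
        let ?p = "cell P (shift g x)"
        have p: "?p \<in> P" by (rule cell_in[OF P(3) shift_in_space[OF x]])
        have "shift g x \<in> C ?p \<longleftrightarrow> shift g y \<in> C ?p"
          using shift_in_space[OF x, of g] shift_in_space[OF y, of g] xy[OF S[OF g p]]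
          by (intro determined_onD[OF EC(2)[OF p]]) (simp_all add: space_measure shift_def)
        moreover have "shift g x \<in> D ?p \<longleftrightarrow> shift g y \<in> D ?p"
          using Zxy[of "(g, ?p)"] g p by (simp add: Z_def)
        moreover have "shift g x \<in> ?p"
          using cell_eq_iff[OF P(3) shift_in_space[OF x] p] by blast
        ultimately have "shift g y \<in> ?p" by (auto simp: D_def)
        then have "cell P (shift g y) = ?p" using cell_eq_iff[OF P(3) shift_in_space[OF y] p] by blast
        then show ?thesis by simp
      qed
      then show "block (cell P) (box n) x = block (cell P) (box n) y" by (simp add: block_eq_iff)
    qed
    also have "\<dots> \<le> obs_entropy \<mu> (block letter S) + obs_entropy \<mu> (\<lambda>x. \<lambda>i\<in>box n \<times> P. Z i x)"
      using finS finI sfZ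
      by (intro obs_entropy_Pair_le simple_function_block simple_function_letter simple_function_tuple)
    also have "obs_entropy \<mu> (block letter S) = ?a (n + 2 * m)"
      unfolding S_def by (intro block_entropy_translate simple_function_letter finite_box)
    also have "obs_entropy \<mu> (\<lambda>x. \<lambda>i\<in>box n \<times> P. Z i x) \<le> (\<Sum>i\<in>box n \<times> P. obs_entropy \<mu> (Z i))"
      by (intro obs_entropy_tuple_le finI sfZ)
    also have "(\<Sum>i\<in>box n \<times> P. obs_entropy \<mu> (Z i)) \<le> (\<Sum>i\<in>box n \<times> P. e')"
    proof (rule sum_mono)
      fix i assume "i \<in> box n \<times> P"
      then have p: "snd i \<in> P" by auto
      show "obs_entropy \<mu> (Z i) \<le> e'"
        unfolding Z_def[abs_def] using entropy_shift[OF sfD[OF p]] HD[OF p] by simp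
    qed
    also have "\<dots> = (real n)\<^sup>2 * (real (card P) * e')"
      by (simp add: card_cartesian_product box_def power2_eq_square)
    also have "\<dots> \<le> (real n)\<^sup>2 * e"
      using e by (intro mult_left_mono) (auto simp: e'_def field_simps)
    finally show ?thesis by simp
  qed
  have "(\<lambda>n. ?a (n + 2 * m) / (real (n + 2 * m))\<^sup>2) \<longlonglongrightarrow> obs_rate letter"
    by (rule LIMSEQ_ignore_initial_segment[OF obs_rate_tendsto[OF simple_function_letter]])
  moreover have "(\<lambda>n. (real (n + 2 * m) / real n)\<^sup>2) \<longlonglongrightarrow> 1" by real_asymp
  ultimately have "(\<lambda>n. ?a (n + 2 * m) / (real (n + 2 * m))\<^sup>2 * (real (n + 2 * m) / real n)\<^sup>2 + e)
      \<longlonglongrightarrow> obs_rate letter * 1 + e"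
    by (intro tendsto_intros)
  moreover have "\<forall>\<^sub>F n in sequentially. ?b n / (real n)\<^sup>2 \<le>
      ?a (n + 2 * m) / (real (n + 2 * m))\<^sup>2 * (real (n + 2 * m) / real n)\<^sup>2 + e"
    using eventually_gt_at_top[of "0::nat"]
  proof eventually_elim
    case (elim n)
    have "?b n / (real n)\<^sup>2 \<le> (?a (n + 2 * m) + (real n)\<^sup>2 * e) / (real n)\<^sup>2"
      by (intro divide_right_mono bound) simp
    also have "\<dots> = ?a (n + 2 * m) / (real n)\<^sup>2 + e"
      using elim by (simp add: add_divide_distrib)
    also have "?a (n + 2 * m) / (real n)\<^sup>2 =
        ?a (n + 2 * m) / (real (n + 2 * m))\<^sup>2 * (real (n + 2 * m) / real n)\<^sup>2"
      using elim by (simp add: power_divide)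
    finally show ?case .
  qed
  ultimately show "obs_rate (cell P) \<le> obs_rate letter + e"
    using tendsto_le[OF _ _ obs_rate_tendsto[OF simple_function_cell[OF assms]]] by simp
qed

lemma ks_entropy_eq_obs_rate: "ks_entropy \<mu> = obs_rate letter"
proof -
  define Q where "Q = (\<lambda>a. letter -` {a} \<inter> space \<mu>) ` letter ` space \<mu>"
  have part: "partition_on (space \<mu>) Q"
    by (rule partition_onI) (auto simp: Q_def disjnt_def)
  have Q: "finite_partition \<mu> Q"
    unfolding finite_partition_def
    using part simple_functionD[OF simple_function_letter] by (auto simp: Q_def)
  have cell: "cell Q x = cell Q y \<longleftrightarrow> letter x = letter y" if "x \<in> space \<mu>" "y \<in> space \<mu>" for x y
  proof -
    have x: "letter -` {letter x} \<inter> space \<mu> \<in> Q" using that by (auto simp: Q_def)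
    have "cell Q x = letter -` {letter x} \<inter> space \<mu>"
      using cell_eq_iff[OF part that(1) x] that by simp
    then have "cell Q y = cell Q x \<longleftrightarrow> y \<in> letter -` {letter x} \<inter> space \<mu>"
      using cell_eq_iff[OF part that(2) x] by (simp only:)
    then show ?thesis using that(2) by (simp add: eq_commute)
  qed
  have "obs_entropy \<mu> (block (cell Q) (box n)) = obs_entropy \<mu> (block letter (box n))" for n
  proof (rule antisym)
    show "obs_entropy \<mu> (block (cell Q) (box n)) \<le> obs_entropy \<mu> (block letter (box n))"
      by (rule obs_entropy_determined[OF simple_function_block[OF simple_function_letter finite_box]])
        (simp add: block_eq_iff cell shift_in_space)
    show "obs_entropy \<mu> (block letter (box n)) \<le> obs_entropy \<mu> (block (cell Q) (box n))"
      by (rule obs_entropy_determined[OF simple_function_block[OF simple_function_cell[OF Q] finite_box]])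
        (simp add: block_eq_iff cell shift_in_space)
  qed
  then have rate: "entropy_rate \<mu> Q = obs_rate letter"
    by (simp add: entropy_rate_eq_obs_rate[OF Q] obs_rate_def)
  show ?thesis
    unfolding ks_entropy_def
  proof (rule cSup_eq_maximum)
    show "obs_rate letter \<in> entropy_rate \<mu> ` {P. finite_partition \<mu> P}"
      using Q rate by force
    show "r \<le> obs_rate letter" if "r \<in> entropy_rate \<mu> ` {P. finite_partition \<mu> P}" for r
      using that by (auto simp: entropy_rate_eq_obs_rate obs_rate_cell_le_letter)
  qed
qed

lemma ks_entropy_tendsto:
  "(\<lambda>n. obs_entropy \<mu> (block letter (box n)) / (real n)\<^sup>2) \<longlonglongrightarrow> ks_entropy \<mu>"
  unfolding ks_entropy_eq_obs_rate by (rule obs_rate_tendsto[OF simple_function_letter])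

lemma ks_entropy_le_block:
  "0 < m \<Longrightarrow> ks_entropy \<mu> \<le> obs_entropy \<mu> (block letter (box m)) / (real m)\<^sup>2"
  unfolding ks_entropy_eq_obs_rate by (rule obs_rate_le[OF simple_function_letter])

lemma ks_entropy_nonneg: "0 \<le> ks_entropy \<mu>"
  by (rule tendsto_lowerbound[OF ks_entropy_tendsto eventuallyI]) (simp_all add: obs_entropy_nonneg)

lemma ks_entropy_le_letter: "ks_entropy \<mu> \<le> obs_entropy \<mu> letter"
proof -
  have "box 1 = {0}" by (auto simp: box_def zero_prod_def)
  then have "obs_entropy \<mu> (block letter (box 1)) \<le> obs_entropy \<mu> letter"
    using simple_function_letter by (intro obs_entropy_determined) (auto simp: block_eq_iff letter_shift)
  then show ?thesis using ks_entropy_le_block[of 1] by simp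
qed

end


section \<open>Single-site potentials and Bernoulli measures\<close>

text \<open>Nonnegativity of the relative entropy of \<open>p\<close> with respect to the weights \<open>exp (\<psi> a) / Z\<close>; it
  follows termwise from \<open>ln t \<le> t - 1\<close>.\<close>

lemma gibbs_inequality:
  fixes p \<psi> :: "'a \<Rightarrow> real"
  assumes A: "finite A" and p: "\<And>a. a \<in> A \<Longrightarrow> 0 \<le> p a" "(\<Sum>a\<in>A. p a) = 1"
  shows "- (\<Sum>a\<in>A. p a * ln (p a)) + (\<Sum>a\<in>A. p a * \<psi> a) \<le> ln (\<Sum>a\<in>A. exp (\<psi> a))"
proof -
  define Z where "Z = (\<Sum>a\<in>A. exp (\<psi> a))"
  have "A \<noteq> {}" using p(2) by auto
  then have Z: "0 < Z" unfolding Z_def using A by (intro sum_pos) auto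
  have "p a * \<psi> a - p a * ln (p a) - p a * ln Z \<le> exp (\<psi> a) / Z - p a" if a: "a \<in> A" for a
  proof (cases "p a = 0")
    case True
    then show ?thesis using Z by simp
  next
    case False
    then have pa: "0 < p a" using p(1)[OF a] by simp
    have "ln (exp (\<psi> a) / Z / p a) \<le> exp (\<psi> a) / Z / p a - 1"
      using Z pa by (intro ln_le_minus_one) simp
    then have "p a * ln (exp (\<psi> a) / Z / p a) \<le> p a * (exp (\<psi> a) / Z / p a - 1)"
      using pa by (intro mult_left_mono) auto
    also have "\<dots> = exp (\<psi> a) / Z - p a" using pa by (simp add: field_simps)
    also have "ln (exp (\<psi> a) / Z / p a) = \<psi> a - ln Z - ln (p a)"
      using Z pa by (simp add: ln_div ln_mult)
    finally show ?thesis by (simp add: algebra_simps)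
  qed
  then have "(\<Sum>a\<in>A. p a * \<psi> a - p a * ln (p a) - p a * ln Z) \<le> (\<Sum>a\<in>A. exp (\<psi> a) / Z - p a)"
    by (rule sum_mono)
  also have "\<dots> = 0"
    using Z by (simp add: sum_subtractf p(2) sum_divide_distrib[symmetric] Z_def[symmetric])
  finally show ?thesis
    by (simp add: sum_subtractf sum_distrib_right[symmetric] p(2) Z_def[symmetric])
qed

context invariant_measure
begin

lemma letter_set_measurable: "{x \<in> space \<mu>. letter x = a} \<in> sets \<mu>"
proof -
  have "letter -` {a} \<inter> space \<mu> = {x \<in> space \<mu>. letter x = a}" by auto
  then show ?thesis using simple_functionD(2)[OF simple_function_letter] by metis
qed

lemma letter_prob_sum: "(\<Sum>a\<in>A. measure \<mu> {x \<in> space \<mu>. letter x = a}) = 1"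
proof -
  have "(\<Sum>a\<in>A. measure \<mu> {x \<in> space \<mu>. letter x = a}) = measure \<mu> (\<Union>a\<in>A. {x \<in> space \<mu>. letter x = a})"
    using letter_set_measurable finite_alphabet
    by (intro finite_measure_finite_Union[symmetric]) (auto simp: disjoint_family_on_def)
  also have "(\<Union>a\<in>A. {x \<in> space \<mu>. letter x = a}) = space \<mu>"
    by (auto simp: space_measure full_shift_def)
  finally show ?thesis by (simp add: prob_space)
qed

lemma obs_entropy_letter:
  "obs_entropy \<mu> letter = - (\<Sum>a\<in>A. measure \<mu> {x \<in> space \<mu>. letter x = a} * ln (measure \<mu> {x \<in> space \<mu>. letter x = a}))"
proof -
  have "letter -` {a} \<inter> space \<mu> = {x \<in> space \<mu>. letter x = a}" for a by auto
  then show ?thesis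
    by (subst obs_entropy_superset[OF finite_alphabet]) (auto simp: space_measure full_shift_def)
qed

lemma integral_letter:
  fixes \<psi> :: "nat \<Rightarrow> real"
  shows "(\<integral>x. \<psi> (letter x) \<partial>\<mu>) = (\<Sum>a\<in>A. measure \<mu> {x \<in> space \<mu>. letter x = a} * \<psi> a)"
proof -
  have "(\<integral>x. \<psi> (letter x) \<partial>\<mu>) =
      (\<integral>x. (\<Sum>a\<in>A. \<psi> a * indicator {x \<in> space \<mu>. letter x = a} x) \<partial>\<mu>)"
  proof (rule Bochner_Integration.integral_cong[OF refl])
    fix x assume x: "x \<in> space \<mu>"
    then have "letter x \<in> A" by (auto simp: space_measure full_shift_def)
    moreover have "(\<Sum>a\<in>A. \<psi> a * indicator {x \<in> space \<mu>. letter x = a} x) =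
        (\<Sum>a\<in>A. if letter x = a then \<psi> a else 0)"
      using x by (intro sum.cong) (auto simp: indicator_def)
    ultimately show "\<psi> (letter x) = (\<Sum>a\<in>A. \<psi> a * indicator {x \<in> space \<mu>. letter x = a} x)"
      using finite_alphabet by simp
  qed
  also have "\<dots> = (\<Sum>a\<in>A. \<psi> a * measure \<mu> {x \<in> space \<mu>. letter x = a})"
    using letter_set_measurable by (subst Bochner_Integration.integral_sum) (auto simp: less_top[symmetric])
  finally show ?thesis by (simp add: mult.commute)
qed

lemma single_site_variational_bound:
  "ks_entropy \<mu> + (\<integral>x. \<psi> (letter x) \<partial>\<mu>) \<le> ln (\<Sum>a\<in>A. exp (\<psi> a))"
  using ks_entropy_le_letter gibbs_inequality[OF finite_alphabet _ letter_prob_sum, of \<psi>]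
  by (simp add: obs_entropy_letter integral_letter)

lemma ks_entropy_le_ln_card: "ks_entropy \<mu> \<le> ln (card A)"
  using single_site_variational_bound[of "\<lambda>_. 0"] by simp

end

text \<open>The identity map only replaces the product sigma-algebra of the discrete alphabets by the Borel
  sigma-algebra of the full shift.\<close>

definition bernoulli :: "nat set \<Rightarrow> (nat \<Rightarrow> real) \<Rightarrow> config measure" where
  "bernoulli A w = distr (Pi\<^sub>M UNIV (\<lambda>_. point_measure A w)) (restrict_space borel (full_shift A)) (\<lambda>x. x)"

locale bernoulli_weights =
  fixes A :: "nat set" and w :: "nat \<Rightarrow> real"
  assumes fin: "finite A" and pos: "\<And>a. a \<in> A \<Longrightarrow> 0 < w a" and sum_w: "(\<Sum>a\<in>A. w a) = 1"
begin

lemma nonempty: "A \<noteq> {}"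
  using sum_w by auto

abbreviation N :: "config measure" where
  "N \<equiv> Pi\<^sub>M UNIV (\<lambda>_. point_measure A w)"

lemma prob_space_point: "prob_space (point_measure A w)"
  using fin pos sum_w by (intro prob_space_point_measure) (auto simp: less_imp_le sum_ennreal)

lemma product_prob: "product_prob_space (\<lambda>_ :: int \<times> int. point_measure A w)"
proof -
  interpret P: prob_space "point_measure A w" by (rule prob_space_point)
  show ?thesis by unfold_locales
qed

lemma space_N: "space N = full_shift A"
  by (auto simp: space_PiM space_point_measure full_shift_def PiE_def)

lemma id_measurable: "(\<lambda>x. x) \<in> measurable N (restrict_space borel (full_shift A))"
proof (rule measurable_restrict_space2)
  show "(\<lambda>x. x) \<in> space N \<rightarrow> full_shift A" by (simp add: space_N)
  have "(\<lambda>x. x) \<in> measurable N (Pi\<^sub>M UNIV (\<lambda>_ :: int \<times> int. borel :: nat measure))"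
  proof (rule measurable_PiM_single')
    fix g :: "int \<times> int"
    have "(\<lambda>x. x g) \<in> measurable N (point_measure A w)" by (rule measurable_component_singleton) simp
    moreover have "(\<lambda>a. a) \<in> measurable (point_measure A w) (borel :: nat measure)"
      by (auto simp: measurable_def sets_point_measure space_point_measure)
    ultimately show "(\<lambda>x. x g) \<in> borel_measurable N" by (rule measurable_compose)
  qed (simp add: PiE_def)
  then show "(\<lambda>x. x) \<in> borel_measurable N"
    by (simp add: measurable_cong_sets[OF refl sets_PiM_equal_borel])
qed

lemma bernoulli_in_inv_measures: "bernoulli A w \<in> inv_measures A"
proof -
  interpret product_prob_space "\<lambda>_ :: int \<times> int. point_measure A w" UNIV by (rule product_prob)
  let ?R = "restrict_space borel (full_shift A) :: config measure"
  have prob: "prob_space (bernoulli A w)"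
    unfolding bernoulli_def by (rule prob_space_distr[OF id_measurable])
  have shiftN: "shift g \<in> measurable N N" for g
    unfolding shift_def
    by (rule measurable_PiM_single') (auto simp: space_PiM PiE_def intro: measurable_component_singleton)
  have "distr N N (shift g) = N" for g
  proof -
    have "distr N N (\<lambda>x. \<lambda>h\<in>UNIV. x (h + g)) = N"
      using prob_space_point by (intro distr_PiM_reindex) (auto simp: inj_on_def)
    then show ?thesis by (simp add: shift_def[abs_def] restrict_def)
  qed
  moreover have "distr (bernoulli A w) (bernoulli A w) (shift g) = bernoulli A w" if "distr N N (shift g) = N" for g
  proof -
    have "distr (bernoulli A w) (bernoulli A w) (shift g) = distr (bernoulli A w) ?R (shift g)"
      by (rule distr_cong) (simp_all add: bernoulli_def)
    also have "\<dots> = distr N ?R (shift g)"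
      unfolding bernoulli_def by (subst distr_distr[OF shift_measurable_full_shift id_measurable]) (simp add: comp_def)
    also have "\<dots> = distr (distr N N (shift g)) ?R (\<lambda>x. x)"
      by (subst distr_distr[OF id_measurable shiftN]) (simp add: comp_def)
    also have "\<dots> = bernoulli A w" unfolding that by (simp add: bernoulli_def)
    finally show ?thesis .
  qed
  ultimately show ?thesis
    using prob by (simp add: inv_measures_def bernoulli_def space_restrict_space)
qed

sublocale invariant_measure A "bernoulli A w"
  by unfold_locales (auto simp: fin nonempty bernoulli_in_inv_measures)

lemma cylinder_prob:
  assumes F: "finite F" and v: "\<And>g. g \<in> F \<Longrightarrow> v g \<in> A"
  shows "measure (bernoulli A w) {x \<in> full_shift A. \<forall>g\<in>F. x g = v g} = (\<Prod>g\<in>F. w (v g))"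
proof -
  interpret P: product_prob_space "\<lambda>_ :: int \<times> int. point_measure A w" UNIV by (rule product_prob)
  have "determined_on A F {x \<in> full_shift A. \<forall>g\<in>F. x g = v g}"
    by (rule determined_onI) auto
  then have "{x \<in> full_shift A. \<forall>g\<in>F. x g = v g} \<in> sets (bernoulli A w)"
    by (rule determined_on_measurable[OF F])
  then have "measure (bernoulli A w) {x \<in> full_shift A. \<forall>g\<in>F. x g = v g} =
      measure N {x \<in> space N. \<forall>g\<in>F. x g \<in> {v g}}"
    unfolding bernoulli_def space_N
    by (subst measure_distr[OF id_measurable]) (auto intro!: arg_cong[where f = "measure N"] simp: space_N)
  also have "\<dots> = (\<Prod>g\<in>F. measure (point_measure A w) {v g})"
  proof -
    have "{x \<in> space N. \<forall>g\<in>F. x g \<in> {v g}} = P.emb UNIV F (Pi\<^sub>E F (\<lambda>g. {v g}))"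
      using v by (auto simp: prod_emb_def space_PiM space_point_measure)
    then show ?thesis
      using P.measure_PiM_emb[OF _ F, of "\<lambda>g. {v g}"] v by (simp add: sets_point_measure)
  qed
  also have "\<dots> = (\<Prod>g\<in>F. w (v g))"
    using fin pos v by (intro prod.cong)
      (simp_all add: measure_def emeasure_point_measure_finite less_imp_le)
  finally show ?thesis .
qed

lemma bernoulli_block_entropy:
  assumes F: "finite F"
  shows "obs_entropy (bernoulli A w) (block letter F) = real (card F) * - (\<Sum>a\<in>A. w a * ln (w a))"
proof -
  let ?V = "F \<rightarrow>\<^sub>E A"
  have cyl: "block letter F -` {v} \<inter> space (bernoulli A w) = {x \<in> full_shift A. \<forall>g\<in>F. x g = v g}"
    if "v \<in> ?V" for v
    using that unfolding space_measure
    by (auto simp: block_def letter_shift PiE_iff extensional_def fun_eq_iff)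
  have "obs_entropy (bernoulli A w) (block letter F) =
      - (\<Sum>v\<in>?V. (\<Prod>g\<in>F. w (v g)) * ln (\<Prod>g\<in>F. w (v g)))"
  proof (subst obs_entropy_superset[of ?V])
    show "finite ?V" using F fin by (rule finite_PiE)
    show "block letter F ` space (bernoulli A w) \<subseteq> ?V"
      by (auto simp: block_def letter_shift space_measure full_shift_def)
    have "measure (bernoulli A w) (block letter F -` {v} \<inter> space (bernoulli A w)) = (\<Prod>g\<in>F. w (v g))"
      if "v \<in> ?V" for v
      unfolding cyl[OF that] by (rule cylinder_prob[OF F]) (use that in auto)
    then show "- (\<Sum>v\<in>?V. measure (bernoulli A w) (block letter F -` {v} \<inter> space (bernoulli A w)) *
        ln (measure (bernoulli A w) (block letter F -` {v} \<inter> space (bernoulli A w)))) =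
        - (\<Sum>v\<in>?V. (\<Prod>g\<in>F. w (v g)) * ln (\<Prod>g\<in>F. w (v g)))"
      by simp
  qed
  (* Each summand becomes a product over the sites, so that the sum over all words factorizes. *)
  also have "(\<Sum>v\<in>?V. (\<Prod>g\<in>F. w (v g)) * ln (\<Prod>g\<in>F. w (v g))) =
      (\<Sum>v\<in>?V. \<Sum>h\<in>F. \<Prod>g\<in>F. if g = h then w (v g) * ln (w (v g)) else w (v g))"
  proof (rule sum.cong[OF refl])
    fix v assume v: "v \<in> ?V"
    have "ln (\<Prod>g\<in>F. w (v g)) = (\<Sum>h\<in>F. ln (w (v h)))"
      using F v by (intro ln_prod) (metis PiE_mem pos less_irrefl)+
    then have "(\<Prod>g\<in>F. w (v g)) * ln (\<Prod>g\<in>F. w (v g)) = (\<Sum>h\<in>F. (\<Prod>g\<in>F. w (v g)) * ln (w (v h)))"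
      by (simp add: sum_distrib_left)
    also have "\<dots> = (\<Sum>h\<in>F. \<Prod>g\<in>F. if g = h then w (v g) * ln (w (v g)) else w (v g))"
    proof (rule sum.cong[OF refl])
      fix h assume h: "h \<in> F"
      have "(\<Prod>g\<in>F. if g = h then w (v g) * ln (w (v g)) else w (v g)) =
          (\<Prod>g\<in>F. w (v g) * (if g = h then ln (w (v g)) else 1))"
        by (rule prod.cong) auto
      then show "(\<Prod>g\<in>F. w (v g)) * ln (w (v h)) =
          (\<Prod>g\<in>F. if g = h then w (v g) * ln (w (v g)) else w (v g))"
        using F h by (simp add: prod.distrib)
    qed
    finally show "(\<Prod>g\<in>F. w (v g)) * ln (\<Prod>g\<in>F. w (v g)) =
        (\<Sum>h\<in>F. \<Prod>g\<in>F. if g = h then w (v g) * ln (w (v g)) else w (v g))" .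
  qed
  also have "\<dots> = (\<Sum>h\<in>F. \<Sum>v\<in>?V. \<Prod>g\<in>F. if g = h then w (v g) * ln (w (v g)) else w (v g))"
    by (rule sum.swap)
  also have "\<dots> = (\<Sum>h\<in>F. \<Sum>a\<in>A. w a * ln (w a))"
  proof (rule sum.cong[OF refl])
    fix h assume h: "h \<in> F"
    have "(\<Sum>v\<in>?V. \<Prod>g\<in>F. if g = h then w (v g) * ln (w (v g)) else w (v g)) =
        (\<Prod>g\<in>F. \<Sum>a\<in>A. if g = h then w a * ln (w a) else w a)"
      by (rule prod_sum_PiE[symmetric]) (use F fin in auto)
    also have "\<dots> = (\<Prod>g\<in>F. if g = h then (\<Sum>a\<in>A. w a * ln (w a)) else 1)"
      by (rule prod.cong) (auto simp: sum_w)
    finally show "(\<Sum>v\<in>?V. \<Prod>g\<in>F. if g = h then w (v g) * ln (w (v g)) else w (v g)) =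
        (\<Sum>a\<in>A. w a * ln (w a))"
      using F h by simp
  qed
  finally show ?thesis by simp
qed

lemma ks_entropy_bernoulli: "ks_entropy (bernoulli A w) = - (\<Sum>a\<in>A. w a * ln (w a))"
proof (rule LIMSEQ_unique[OF ks_entropy_tendsto])
  have "\<forall>\<^sub>F n in sequentially. - (\<Sum>a\<in>A. w a * ln (w a)) =
      obs_entropy (bernoulli A w) (block letter (box n)) / (real n)\<^sup>2"
    using eventually_gt_at_top[of "0::nat"]
  proof eventually_elim
    case (elim n)
    have "real (card (box n)) = (real n)\<^sup>2"
      by (simp add: box_def card_cartesian_product power2_eq_square)
    then show ?case using elim by (simp add: bernoulli_block_entropy finite_box)
  qed
  then show "(\<lambda>n. obs_entropy (bernoulli A w) (block letter (box n)) / (real n)\<^sup>2)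
      \<longlonglongrightarrow> - (\<Sum>a\<in>A. w a * ln (w a))"
    by (rule Lim_transform_eventually[rotated]) simp
qed

lemma bernoulli_letter_prob:
  assumes "a \<in> A"
  shows "measure (bernoulli A w) {x \<in> full_shift A. x g = a} = w a"
  using cylinder_prob[of "{g}" "\<lambda>_. a"] assms by simp

end

definition gibbs_weight :: "nat set \<Rightarrow> (nat \<Rightarrow> real) \<Rightarrow> nat \<Rightarrow> real" where
  "gibbs_weight A \<psi> a = exp (\<psi> a) / (\<Sum>b\<in>A. exp (\<psi> b))"

lemma gibbs_weights:
  assumes "finite A" "A \<noteq> {}"
  shows "bernoulli_weights A (gibbs_weight A \<psi>)"
proof -
  have "0 < (\<Sum>b\<in>A. exp (\<psi> b))" using assms by (intro sum_pos) auto
  then show ?thesis using assms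
    by unfold_locales (auto simp: gibbs_weight_def sum_divide_distrib[symmetric])
qed

text \<open>The weights proportional to \<open>exp (\<psi> a)\<close> are the case of equality in the Gibbs inequality, and
  for a Bernoulli measure the entropy of one letter is the whole entropy.\<close>

lemma
  fixes \<psi> :: "nat \<Rightarrow> real"
  assumes A: "finite A" "A \<noteq> {}"
  shows single_site_pressure: "pressure A (\<lambda>x. \<psi> (letter x)) = ln (\<Sum>a\<in>A. exp (\<psi> a))"
    and gibbs_equilibrium_state:
      "equilibrium_state A (\<lambda>x. \<psi> (letter x)) (bernoulli A (gibbs_weight A \<psi>))"
proof -
  interpret bernoulli_weights A "gibbs_weight A \<psi>" by (rule gibbs_weights[OF A])
  let ?Z = "\<Sum>a\<in>A. exp (\<psi> a)" and ?w = "gibbs_weight A \<psi>"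
  let ?B = "bernoulli A ?w"
  have Z: "0 < ?Z" using A by (intro sum_pos) auto
  have "ks_entropy ?B + (\<integral>x. \<psi> (letter x) \<partial>?B) = - (\<Sum>a\<in>A. ?w a * ln (?w a)) + (\<Sum>a\<in>A. ?w a * \<psi> a)"
    unfolding ks_entropy_bernoulli integral_letter
    by (simp add: space_measure bernoulli_letter_prob)
  also have "(\<Sum>a\<in>A. ?w a * ln (?w a)) = (\<Sum>a\<in>A. ?w a * \<psi> a - ?w a * ln ?Z)"
    using Z by (intro sum.cong) (simp_all add: gibbs_weight_def ln_div right_diff_distrib)
  also have "\<dots> = (\<Sum>a\<in>A. ?w a * \<psi> a) - ln ?Z"
    by (simp add: sum_subtractf sum_distrib_right[symmetric] sum_w)
  finally have val: "ks_entropy ?B + (\<integral>x. \<psi> (letter x) \<partial>?B) = ln ?Z" by simp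
  show press: "pressure A (\<lambda>x. \<psi> (letter x)) = ln ?Z"
    unfolding pressure_def
  proof (rule cSup_eq_maximum)
    show "ln ?Z \<in> (\<lambda>\<mu>. ks_entropy \<mu> + (\<integral>x. \<psi> (letter x) \<partial>\<mu>)) ` inv_measures A"
      using invariant val by force
    fix r assume "r \<in> (\<lambda>\<mu>. ks_entropy \<mu> + (\<integral>x. \<psi> (letter x) \<partial>\<mu>)) ` inv_measures A"
    then obtain \<mu> where \<mu>: "\<mu> \<in> inv_measures A" "r = ks_entropy \<mu> + (\<integral>x. \<psi> (letter x) \<partial>\<mu>)" by blast
    interpret M: invariant_measure A \<mu> using A \<mu>(1) by unfold_locales
    show "r \<le> ln ?Z" using M.single_site_variational_bound \<mu>(2) by simp
  qed
  show "equilibrium_state A (\<lambda>x. \<psi> (letter x)) ?B"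
    unfolding equilibrium_state_def press using val invariant by simp
qed


section \<open>Ground states\<close>

lemma continuous_on_letter_function:
  fixes f :: "nat \<Rightarrow> real"
  shows "continuous_on S (\<lambda>x::config. f (x g))"
proof (rule continuous_on_compose2[OF _ continuous_on_coordinate])
  show "continuous_on UNIV f" by (simp add: continuous_on_open_vimage open_discrete)
qed simp

text \<open>Letters are discrete, so the indicator of a cylinder is a continuous test function.\<close>

lemma weak_star_limit_cylinder:
  assumes A: "finite A" "A \<noteq> {}" and F: "finite F"
    and \<mu>s: "\<And>k. \<mu>s k \<in> inv_measures A" and \<mu>: "\<mu> \<in> inv_measures A"
    and lim: "weak_star_limit A \<mu>s \<mu>"
  shows "(\<lambda>k. measure (\<mu>s k) {x \<in> full_shift A. \<forall>g\<in>F. x g = v g})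
    \<longlonglongrightarrow> measure \<mu> {x \<in> full_shift A. \<forall>g\<in>F. x g = v g}"
proof -
  let ?C = "{x \<in> full_shift A. \<forall>g\<in>F. x g = v g}"
  let ?f = "\<lambda>x::config. \<Prod>g\<in>F. of_bool (x g = v g) :: real"
  have "?f \<in> cont_funs A"
    unfolding cont_funs_def by (auto intro!: continuous_on_prod continuous_on_letter_function)
  then have "(\<lambda>k. \<integral>x. ?f x \<partial>(\<mu>s k)) \<longlonglongrightarrow> (\<integral>x. ?f x \<partial>\<mu>)"
    using lim unfolding weak_star_limit_def by blast
  moreover have "(\<integral>x. ?f x \<partial>\<nu>) = measure \<nu> ?C" if "\<nu> \<in> inv_measures A" for \<nu>
  proof -
    interpret invariant_measure A \<nu> using A that by unfold_locales
    have "determined_on A F ?C" by (rule determined_onI) auto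
    then have C: "?C \<in> sets \<nu>" by (rule determined_on_measurable[OF F])
    have "?f x = indicator ?C x" if "x \<in> space \<nu>" for x
    proof (cases "\<forall>g\<in>F. x g = v g")
      case True
      then show ?thesis using that by (simp add: space_measure indicator_def)
    next
      case False
      then have "?f x = 0" using F by (auto intro: prod_zero)
      then show ?thesis using False by (simp add: indicator_def)
    qed
    then have "(\<integral>x. ?f x \<partial>\<nu>) = (\<integral>x. indicator ?C x \<partial>\<nu>)"
      by (intro Bochner_Integration.integral_cong) auto
    also have "\<dots> = measure \<nu> ?C" using sets.sets_into_space[OF C] by (simp add: Int_absorb2)
    finally show ?thesis .
  qed
  ultimately show ?thesis using \<mu>s \<mu> by simp
qed

lemma weak_star_limit_block_entropy:
  assumes A: "finite A" "A \<noteq> {}" and F: "finite F"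
    and \<mu>s: "\<And>k. \<mu>s k \<in> inv_measures A" and \<mu>: "\<mu> \<in> inv_measures A"
    and lim: "weak_star_limit A \<mu>s \<mu>"
  shows "(\<lambda>k. obs_entropy (\<mu>s k) (block letter F)) \<longlonglongrightarrow> obs_entropy \<mu> (block letter F)"
proof -
  let ?V = "F \<rightarrow>\<^sub>E A" and ?C = "\<lambda>v. {x \<in> full_shift A. \<forall>g\<in>F. x g = v g}"
  have ent: "obs_entropy \<nu> (block letter F) = - (\<Sum>v\<in>?V. measure \<nu> (?C v) * ln (measure \<nu> (?C v)))"
    if "\<nu> \<in> inv_measures A" for \<nu>
  proof -
    interpret invariant_measure A \<nu> using A that by unfold_locales
    have "block letter F -` {v} \<inter> space \<nu> = ?C v" if "v \<in> ?V" for v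
      using that unfolding space_measure
      by (auto simp: block_def letter_shift PiE_iff extensional_def fun_eq_iff)
    then show ?thesis
      using finite_PiE[OF F, of "\<lambda>_. A"] A
      by (subst obs_entropy_superset[of ?V])
         (auto simp: block_def letter_shift space_measure full_shift_def)
  qed
  show ?thesis
    unfolding ent[OF \<mu>s] ent[OF \<mu>]
    by (intro tendsto_minus tendsto_sum tendsto_x_ln_x weak_star_limit_cylinder assms measure_nonneg)
qed

text \<open>Entropy is an infimum of normalized block entropies, and each of these is continuous along a
  weak-* convergent sequence.\<close>

lemma ks_entropy_upper_semicontinuous:
  assumes A: "finite A" "A \<noteq> {}"
    and \<mu>s: "\<And>k. \<mu>s k \<in> inv_measures A" and \<mu>: "\<mu> \<in> inv_measures A"
    and lim: "weak_star_limit A \<mu>s \<mu>" and c: "\<And>k. c \<le> ks_entropy (\<mu>s k)"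
  shows "c \<le> ks_entropy \<mu>"
proof -
  interpret M: invariant_measure A \<mu> using A \<mu> by unfold_locales
  have "c \<le> obs_entropy \<mu> (block letter (box n)) / (real n)\<^sup>2" if n: "0 < n" for n
  proof (rule tendsto_lowerbound)
    show "(\<lambda>k. obs_entropy (\<mu>s k) (block letter (box n)) / (real n)\<^sup>2)
        \<longlonglongrightarrow> obs_entropy \<mu> (block letter (box n)) / (real n)\<^sup>2"
      using n by (intro tendsto_divide tendsto_const weak_star_limit_block_entropy[OF A _ \<mu>s \<mu> lim] M.finite_box) simp
    have "c \<le> obs_entropy (\<mu>s k) (block letter (box n)) / (real n)\<^sup>2" for k
    proof -
      interpret K: invariant_measure A "\<mu>s k" using A \<mu>s by unfold_locales
      show ?thesis using c[of k] K.ks_entropy_le_block[OF n] by linarith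
    qed
    then show "\<forall>\<^sub>F k in sequentially. c \<le> obs_entropy (\<mu>s k) (block letter (box n)) / (real n)\<^sup>2"
      by simp
  qed simp
  then show ?thesis
    by (intro tendsto_lowerbound[OF M.ks_entropy_tendsto]) (auto simp: eventually_sequentially intro!: exI[of _ 1])
qed

lemma ground_state_entropy_eqI:
  assumes "\<exists>\<mu>. ground_state A \<phi> \<mu>" "\<And>\<mu>. ground_state A \<phi> \<mu> \<Longrightarrow> ks_entropy \<mu> = c"
  shows "ground_state_entropy A \<phi> = c"
proof -
  have "ks_entropy ` {\<mu>. ground_state A \<phi> \<mu>} = {c}" using assms by auto
  then show ?thesis unfolding ground_state_entropy_def by simp
qed

text \<open>The potential stays \<open>0\<close> at every temperature, so the equilibrium states are always the measures of
  entropy \<open>ln (card A)\<close>. The uniform Bernoulli measure is one of them, and upper semicontinuity shows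
  that limits of such measures have the same entropy.\<close>

lemma ground_state_entropy_zero:
  assumes A: "finite A" "A \<noteq> {}"
  shows "ground_state_entropy A (\<lambda>x. 0) = ln (card A)"
proof (rule ground_state_entropy_eqI)
  let ?B = "bernoulli A (gibbs_weight A (\<lambda>_. 0))"
  have press: "pressure A (\<lambda>x. 0) = ln (card A)"
    using single_site_pressure[OF A, of "\<lambda>_. 0"] by simp
  have eq: "equilibrium_state A (\<lambda>x. 0) ?B"
    using gibbs_equilibrium_state[OF A, of "\<lambda>_. 0"] by simp
  show "\<exists>\<mu>. ground_state A (\<lambda>x. 0) \<mu>"
  proof
    show "ground_state A (\<lambda>x. 0) ?B"
      unfolding ground_state_def
    proof (intro conjI exI)
      show "?B \<in> inv_measures A" using eq by (simp add: equilibrium_state_def)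
      show "filterlim real at_top sequentially" by (rule filterlim_real_sequentially)
      show "\<forall>k. equilibrium_state A (\<lambda>x. real k * 0) ?B" using eq by simp
      show "weak_star_limit A (\<lambda>_. ?B) ?B" by (simp add: weak_star_limit_def)
    qed
  qed
  fix \<mu> assume gs: "ground_state A (\<lambda>x. 0) \<mu>"
  then obtain \<beta> :: "nat \<Rightarrow> real" and \<mu>s where \<mu>s: "\<And>k. equilibrium_state A (\<lambda>x. \<beta> k * 0) (\<mu>s k)"
      "weak_star_limit A \<mu>s \<mu>" and \<mu>: "\<mu> \<in> inv_measures A"
    unfolding ground_state_def by blast
  interpret M: invariant_measure A \<mu> using A \<mu> by unfold_locales
  have "\<mu>s k \<in> inv_measures A" "ks_entropy (\<mu>s k) = ln (card A)" for k
    using \<mu>s(1)[of k] press by (simp_all add: equilibrium_state_def)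
  then have "ln (card A) \<le> ks_entropy \<mu>"
    by (intro ks_entropy_upper_semicontinuous[OF A _ \<mu> \<mu>s(2)]) auto
  then show "ks_entropy \<mu> = ln (card A)" using M.ks_entropy_le_ln_card by linarith
qed

lemma compact_full_shift:
  assumes "finite A"
  shows "compact (full_shift A)"
proof -
  have "compactin (product_topology (\<lambda>_ :: int \<times> int. euclidean :: nat topology) UNIV) (UNIV \<rightarrow>\<^sub>E A)"
    using assms by (simp add: compactin_PiE finite_imp_compact)
  moreover have "(UNIV \<rightarrow>\<^sub>E A) = full_shift A" by (auto simp: full_shift_def PiE_def)
  ultimately show ?thesis by (simp add: euclidean_product_topology)
qed

lemma full_shift_local:
  assumes f: "continuous_on (full_shift A) (f :: config \<Rightarrow> real)" and y: "y \<in> full_shift A" and e: "0 < e"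
  shows "\<exists>E. finite E \<and> (\<forall>x\<in>full_shift A. (\<forall>g\<in>E. x g = y g) \<longrightarrow> \<bar>f x - f y\<bar> < e)"
proof -
  have "\<exists>U. open U \<and> y \<in> U \<and> (\<forall>x\<in>full_shift A. x \<in> U \<longrightarrow> f x \<in> ball (f y) e)"
    using f[unfolded continuous_on_topological, rule_format, OF y, of "ball (f y) e"] e by auto
  then obtain U where U: "open U" "y \<in> U" "\<And>x. x \<in> full_shift A \<Longrightarrow> x \<in> U \<Longrightarrow> f x \<in> ball (f y) e" by blast
  have "openin (product_topology (\<lambda>_ :: int \<times> int. euclidean :: nat topology) UNIV) U"
    unfolding euclidean_product_topology using U(1) by (simp only: open_openin)
  from product_topology_open_contains_basis[OF this U(2)]
  obtain X where X: "y \<in> Pi\<^sub>E UNIV X" "finite {i. X i \<noteq> topspace (euclidean :: nat topology)}" "Pi\<^sub>E UNIV X \<subseteq> U"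
    by blast
  let ?E = "{i. X i \<noteq> UNIV}"
  have "\<bar>f x - f y\<bar> < e" if x: "x \<in> full_shift A" and "\<forall>g\<in>?E. x g = y g" for x
  proof -
    have "x g \<in> X g" for g
      using that(2) X(1) by (cases "X g = UNIV") (auto simp: PiE_iff)
    then have "x \<in> U" using X(3) by (auto simp: PiE_def)
    from U(3)[OF x this] show ?thesis by (simp add: dist_real_def abs_minus_commute)
  qed
  then show ?thesis using X(2) by (intro exI[of _ ?E]) auto
qed

lemma dirac_in_inv_measures:
  assumes "a \<in> A"
  shows "return (restrict_space borel (full_shift A)) (\<lambda>_. a) \<in> inv_measures A" (is "?D \<in> _")
proof -
  have pt: "(\<lambda>_. a) \<in> space (restrict_space borel (full_shift A))"
    using assms by (simp add: space_restrict_space full_shift_def)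
  have "distr ?D ?D (shift g) = ?D" for g
  proof -
    have "distr ?D ?D (shift g) = distr ?D (restrict_space borel (full_shift A)) (shift g)"
      by (rule distr_cong) simp_all
    also have "\<dots> = return (restrict_space borel (full_shift A)) (shift g (\<lambda>_. a))"
      using shift_measurable_full_shift pt by (intro distr_return) simp_all
    finally show ?thesis by (simp add: shift_def)
  qed
  then show ?thesis
    using prob_space_return[OF pt] by (simp add: inv_measures_def space_restrict_space)
qed

text \<open>By continuity a test function is close to its value at the constant configuration unless some letter
  in a finite set \<open>E\<close> of sites differs from \<open>a\<close>. By shift invariance and the union bound this
  exceptional event has probability at most \<open>card E\<close> times that of a wrong letter at a single site.\<close>

lemma weak_star_limit_dirac:
  assumes A: "finite A" and a: "a \<in> A" and \<mu>s: "\<And>k. \<mu>s k \<in> inv_measures A"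
    and lim: "(\<lambda>k. measure (\<mu>s k) {x \<in> full_shift A. letter x = a}) \<longlonglongrightarrow> 1"
  shows "weak_star_limit A \<mu>s (return (restrict_space borel (full_shift A)) (\<lambda>_. a))"
  unfolding weak_star_limit_def
proof
  let ?y = "\<lambda>_. a" and ?R = "restrict_space borel (full_shift A)"
  have y: "?y \<in> full_shift A" using a by (simp add: full_shift_def)
  fix f assume "f \<in> cont_funs A"
  then have f: "continuous_on (full_shift A) f" by (simp add: cont_funs_def)
  have "bounded (f ` full_shift A)"
    by (intro compact_imp_bounded compact_continuous_image f compact_full_shift A)
  then obtain M where M: "\<And>x. x \<in> full_shift A \<Longrightarrow> \<bar>f x\<bar> \<le> M"
    by (auto simp: bounded_iff)
  have "(\<integral>x. f x \<partial>(return ?R ?y)) = f ?y"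
    using y borel_measurable_continuous_on_restrict[OF f]
    by (intro integral_return) (auto simp: space_restrict_space)
  moreover have "(\<lambda>k. \<integral>x. f x \<partial>(\<mu>s k)) \<longlonglongrightarrow> f ?y"
  proof (rule LIMSEQ_I)
    fix e :: real assume e: "0 < e"
    obtain E where E: "finite E"
        "\<And>x. x \<in> full_shift A \<Longrightarrow> \<forall>g\<in>E. x g = a \<Longrightarrow> \<bar>f x - f ?y\<bar> < e / 2"
      using full_shift_local[OF f y, of "e / 2"] e by auto
    let ?m = "\<lambda>k. measure (\<mu>s k) {x \<in> full_shift A. letter x = a}"
    have bound: "\<bar>(\<integral>x. f x \<partial>(\<mu>s k)) - f ?y\<bar> \<le> e / 2 + 2 * M * (real (card E) * (1 - ?m k))" for k
    proof -
      interpret invariant_measure A "\<mu>s k" using A a \<mu>s by unfold_locales auto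
      have fm: "f \<in> borel_measurable (\<mu>s k)" by (rule continuous_measurable[OF f])
      have int_f: "integrable (\<mu>s k) f"
        using fm M by (intro integrable_const_bound[of _ M]) (auto simp: space_measure)
      let ?S = "\<lambda>g. {x \<in> full_shift A. x g \<noteq> a}"
      have S: "?S g \<in> sets (\<mu>s k)" for g
      proof -
        have "determined_on A {g} (?S g)" by (rule determined_onI) auto
        then show ?thesis by (intro determined_on_measurable) auto
      qed
      have Sg: "measure (\<mu>s k) (?S g) = 1 - ?m k" for g
      proof -
        have "measure (\<mu>s k) (?S g) = measure (distr (\<mu>s k) (\<mu>s k) (shift g)) (?S 0)"
          by (subst measure_distr[OF shift_measurable S])
             (auto simp: letter_shift space_measure full_shift_def shift_def intro!: arg_cong[where f = "measure (\<mu>s k)"])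
        also have "\<dots> = measure (\<mu>s k) (space (\<mu>s k) - {x \<in> full_shift A. letter x = a})"
          unfolding distr_shift by (intro arg_cong[where f = "measure (\<mu>s k)"]) (auto simp: space_measure)
        also have "\<dots> = 1 - ?m k"
          using letter_set_measurable[of a] by (intro prob_compl) (simp add: space_measure)
        finally show ?thesis .
      qed
      have "\<bar>(\<integral>x. f x \<partial>(\<mu>s k)) - f ?y\<bar> = \<bar>\<integral>x. f x - f ?y \<partial>(\<mu>s k)\<bar>"
        using int_f by (simp add: prob_space)
      also have "\<dots> \<le> (\<integral>x. \<bar>f x - f ?y\<bar> \<partial>(\<mu>s k))" by (rule integral_abs_bound)
      also have "\<dots> \<le> (\<integral>x. e / 2 + (\<Sum>g\<in>E. 2 * M * indicator (?S g) x) \<partial>(\<mu>s k))"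
      proof (rule integral_mono)
        show "integrable (\<mu>s k) (\<lambda>x. \<bar>f x - f ?y\<bar>)" using int_f by simp
        show "integrable (\<mu>s k) (\<lambda>x. e / 2 + (\<Sum>g\<in>E. 2 * M * indicator (?S g) x))"
          using S by (intro Bochner_Integration.integrable_add integrable_const Bochner_Integration.integrable_sum
              integrable_mult_right integrable_real_indicator) (auto simp: less_top[symmetric])
        fix x assume "x \<in> space (\<mu>s k)"
        then have x: "x \<in> full_shift A" by (simp add: space_measure)
        have M0: "0 \<le> M" using M[OF y] by linarith
        show "\<bar>f x - f ?y\<bar> \<le> e / 2 + (\<Sum>g\<in>E. 2 * M * indicator (?S g) x)"
        proof (cases "\<forall>g\<in>E. x g = a")
          case True
          then have "\<bar>f x - f ?y\<bar> < e / 2" using E(2)[OF x] by blast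
          moreover have "0 \<le> (\<Sum>g\<in>E. 2 * M * indicator (?S g) x)" using M0 by (intro sum_nonneg) auto
          ultimately show ?thesis by linarith
        next
          case False
          then obtain g where g: "g \<in> E" "x g \<noteq> a" by blast
          have "\<bar>f x - f ?y\<bar> \<le> 2 * M * indicator (?S g) x"
            using M[OF x] M[OF y] g x by simp
          also have "\<dots> \<le> (\<Sum>g\<in>E. 2 * M * indicator (?S g) x)"
            using g M0 by (intro member_le_sum E(1)) auto
          finally show ?thesis using e by linarith
        qed
      qed
      also have "\<dots> = e / 2 + (\<Sum>g\<in>E. 2 * M * measure (\<mu>s k) (?S g))"
        using S by (subst Bochner_Integration.integral_add)
          (auto simp: prob_space less_top[symmetric] intro!: integrable_real_indicator)
      also have "\<dots> = e / 2 + 2 * M * (real (card E) * (1 - ?m k))" by (simp add: Sg)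
      finally show ?thesis .
    qed
    have "(\<lambda>k. e / 2 + 2 * M * (real (card E) * (1 - ?m k)))
        \<longlonglongrightarrow> e / 2 + 2 * M * (real (card E) * (1 - 1))"
      by (intro tendsto_intros lim)
    then have "\<forall>\<^sub>F k in sequentially. e / 2 + 2 * M * (real (card E) * (1 - ?m k)) < e"
      by (rule order_tendstoD) (use e in simp)
    then obtain k0 where k0: "\<And>k. k0 \<le> k \<Longrightarrow> e / 2 + 2 * M * (real (card E) * (1 - ?m k)) < e"
      by (auto simp: eventually_sequentially)
    have "norm ((\<integral>x. f x \<partial>(\<mu>s k)) - f ?y) < e" if "k0 \<le> k" for k
      using bound[of k] k0[OF that] by simp
    then show "\<exists>no. \<forall>k\<ge>no. norm ((\<integral>x. f x \<partial>(\<mu>s k)) - f ?y) < e" by blast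
  qed
  ultimately show "(\<lambda>k. \<integral>x. f x \<partial>(\<mu>s k)) \<longlonglongrightarrow> (\<integral>x. f x \<partial>(return ?R ?y))" by simp
qed

text \<open>The point mass at the constant configuration is the limit of the Bernoulli equilibrium states. For an
  arbitrary ground state, an equilibrium state at inverse temperature \<open>\<beta>\<close> that shows the letter \<open>a\<close>
  with probability \<open>m\<close> loses energy \<open>\<beta> * c * (1 - m)\<close>; entropy can repay at most \<open>ln (card A)\<close>, so
  \<open>m\<close> tends to \<open>1\<close> and the limit has letter entropy \<open>0\<close>.\<close>

lemma ground_state_entropy_letter_indicator:
  assumes A: "finite A" and a: "a \<in> A" and c: "0 < c"
  shows "ground_state_entropy A (\<lambda>x. c * of_bool (letter x = a)) = 0"
proof (rule ground_state_entropy_eqI)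
  have ne: "A \<noteq> {}" using a by blast
  let ?\<phi> = "\<lambda>x :: config. c * of_bool (letter x = a)"
  let ?\<psi> = "\<lambda>\<beta> b. \<beta> * (c * of_bool (b = a)) :: real"
  show "\<exists>\<mu>. ground_state A ?\<phi> \<mu>"
  proof
    let ?w = "\<lambda>k. gibbs_weight A (?\<psi> (real k))"
    let ?B = "\<lambda>k. bernoulli A (?w k)" and ?D = "return (restrict_space borel (full_shift A)) (\<lambda>_. a)"
    have B: "bernoulli_weights A (?w k)" for k by (rule gibbs_weights[OF A ne])
    have eq: "equilibrium_state A (\<lambda>x. real k * ?\<phi> x) (?B k)" for k
      using gibbs_equilibrium_state[OF A ne, of "?\<psi> (real k)"] .
    have m: "measure (?B k) {x \<in> full_shift A. letter x = a} = 1 / (1 + real (card A - 1) * exp (- c * real k))" for k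
    proof -
      have "(\<Sum>b\<in>A. exp (?\<psi> (real k) b)) = exp (real k * c) + (\<Sum>b\<in>A - {a}. exp (?\<psi> (real k) b))"
        using A a by (simp add: sum.remove)
      also have "(\<Sum>b\<in>A - {a}. exp (?\<psi> (real k) b)) = real (card A - 1)"
        using A a by simp
      finally have "?w k a = exp (real k * c) / (exp (real k * c) + real (card A - 1))"
        by (simp add: gibbs_weight_def)
      also have "\<dots> = 1 / (1 + real (card A - 1) * exp (- c * real k))"
        by (simp add: exp_minus field_simps)
      finally show ?thesis using bernoulli_weights.bernoulli_letter_prob[OF B a, of k 0] by simp
    qed
    have "(\<lambda>k. 1 / (1 + real (card A - 1) * exp (- c * real k))) \<longlonglongrightarrow> 1"
      using c by real_asymp
    then have lim: "weak_star_limit A ?B ?D"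
      using bernoulli_weights.bernoulli_in_inv_measures[OF B]
      by (intro weak_star_limit_dirac A a) (simp_all only: m)
    show "ground_state A ?\<phi> ?D"
      unfolding ground_state_def
    proof (intro conjI exI)
      show "?D \<in> inv_measures A" by (rule dirac_in_inv_measures[OF a])
      show "filterlim real at_top sequentially" by (rule filterlim_real_sequentially)
      show "\<forall>k. equilibrium_state A (\<lambda>x. real k * ?\<phi> x) (?B k)" using eq by blast
      show "weak_star_limit A ?B ?D" by (rule lim)
    qed
  qed
  fix \<mu> assume "ground_state A ?\<phi> \<mu>"
  then obtain \<beta> \<mu>s where \<beta>: "filterlim \<beta> at_top sequentially"
      and \<mu>s: "\<And>k. equilibrium_state A (\<lambda>x. \<beta> k * ?\<phi> x) (\<mu>s k)" "weak_star_limit A \<mu>s \<mu>"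
      and \<mu>: "\<mu> \<in> inv_measures A"
    unfolding ground_state_def by blast
  interpret M: invariant_measure A \<mu> using A ne \<mu> by unfold_locales
  have \<mu>s_inv: "\<mu>s k \<in> inv_measures A" for k using \<mu>s(1) by (simp add: equilibrium_state_def)
  let ?m = "\<lambda>k. measure (\<mu>s k) {x \<in> full_shift A. letter x = a}"
  have defect: "1 - ln (card A) / c * inverse (\<beta> k) \<le> ?m k" if pos: "0 < \<beta> k" for k
  proof -
    interpret K: invariant_measure A "\<mu>s k" using A ne \<mu>s_inv by unfold_locales
    have "(\<integral>x. ?\<psi> (\<beta> k) (letter x) \<partial>(\<mu>s k)) = (\<Sum>b\<in>A. if b = a then ?m k * (\<beta> k * c) else 0)"
      unfolding K.integral_letter[of "?\<psi> (\<beta> k)"] K.space_measure by (rule sum.cong) auto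
    also have "\<dots> = ?m k * (\<beta> k * c)" using A a by simp
    finally have int: "(\<integral>x. ?\<psi> (\<beta> k) (letter x) \<partial>(\<mu>s k)) = ?m k * (\<beta> k * c)" .
    have "\<beta> k * c = ln (exp (?\<psi> (\<beta> k) a))" by simp
    also have "\<dots> \<le> ln (\<Sum>b\<in>A. exp (?\<psi> (\<beta> k) b))"
      using A a by (intro ln_mono member_le_sum[of a A "\<lambda>b. exp (?\<psi> (\<beta> k) b)"]) auto
    also have "\<dots> = ks_entropy (\<mu>s k) + ?m k * (\<beta> k * c)"
      using \<mu>s(1)[of k] unfolding equilibrium_state_def int single_site_pressure[OF A ne, of "?\<psi> (\<beta> k)"]
      by simp
    also have "\<dots> \<le> ln (card A) + ?m k * (\<beta> k * c)" using K.ks_entropy_le_ln_card by simp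
    finally have "(1 - ?m k) * (\<beta> k * c) \<le> ln (card A)" by (simp add: algebra_simps)
    then have "1 - ?m k \<le> ln (card A) / (\<beta> k * c)" using pos c by (simp add: pos_le_divide_eq)
    then show ?thesis by (simp add: field_simps)
  qed
  have "(\<lambda>k. 1 - ln (card A) / c * inverse (\<beta> k)) \<longlonglongrightarrow> 1 - ln (card A) / c * 0"
    by (intro tendsto_intros tendsto_inverse_0_at_top \<beta>)
  moreover have "?m \<longlonglongrightarrow> measure \<mu> {x \<in> full_shift A. letter x = a}"
    using weak_star_limit_cylinder[OF A ne _ \<mu>s_inv \<mu> \<mu>s(2), of "{0}" "\<lambda>_. a"] by simp
  moreover have "\<forall>\<^sub>F k in sequentially. 1 - ln (card A) / c * inverse (\<beta> k) \<le> ?m k"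
    using filterlim_at_top_dense[THEN iffD1, OF \<beta>, rule_format, of 0] by eventually_elim (rule defect)
  ultimately have "1 \<le> measure \<mu> {x \<in> full_shift A. letter x = a}"
    using tendsto_le[OF sequentially_bot] by fastforce
  then have one: "measure \<mu> {x \<in> space \<mu>. letter x = a} = 1"
    using M.prob_le_1 by (intro antisym) (auto simp: M.space_measure)
  have "(\<Sum>b\<in>A - {a}. measure \<mu> {x \<in> space \<mu>. letter x = b}) = 0"
    using M.letter_prob_sum one A a by (simp add: sum.remove)
  then have zero: "measure \<mu> {x \<in> space \<mu>. letter x = b} = 0" if "b \<in> A" "b \<noteq> a" for b
    using that A by (subst (asm) sum_nonneg_eq_0_iff) auto
  have "obs_entropy \<mu> letter = 0"
    unfolding M.obs_entropy_letter neg_equal_0_iff_equal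
    by (intro sum.neutral ballI) (use one zero in fastforce)
  then show "ks_entropy \<mu> = 0"
    using M.ks_entropy_le_letter M.ks_entropy_nonneg by linarith
qed

theorem mainTheorem8:
  shows "\<exists>A :: nat set. finite A \<and> A \<noteq> {} \<and>
    \<not> computable_functional A (ground_state_entropy A)"
proof (intro exI conjI notI)
  let ?A = "{0, 1} :: nat set" and ?f = "\<lambda>x :: config. of_bool (letter x = 0) :: real"
  assume comp: "computable_functional ?A (ground_state_entropy ?A)"
  have "rational_locally_constant ?A ?f"
    unfolding rational_locally_constant_def by (auto intro!: exI[of _ "{0}"])
  moreover have "?f \<in> cont_funs ?A"
    unfolding cont_funs_def
    using continuous_on_letter_function[of _ "\<lambda>n. of_bool (n = 0)" 0] by blast
  (* Precision (1/2)^2 suffices: twice it is 1/2, and ln 2 is larger. *)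
  ultimately obtain K where K: "\<bar>ground_state_entropy ?A (\<lambda>x. (1/2) ^ K * ?f x) -
      ground_state_entropy ?A (\<lambda>x. 0)\<bar> < 2 * (1/2) ^ 2"
    using computable_functional_near_zero[OF comp, of ?f 2] by auto
  have "ground_state_entropy ?A (\<lambda>x. (1/2) ^ K * ?f x) = 0"
    by (rule ground_state_entropy_letter_indicator) auto
  moreover have "ground_state_entropy ?A (\<lambda>x. 0) = ln 2"
    using ground_state_entropy_zero[of ?A] by simp
  ultimately have "ln 2 < (1/2 :: real)" using K by (simp add: power2_eq_square)
  then show False using ln2_ge_two_thirds by simp
qed auto

end
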